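(* Let $\Sigma$ be a finite alphabet, let $\rho>0$, and let $S,T\in\Sigma^*$ be nonempty strings of lengths $m=|S|$ and $n=|T|$. The algorithm described in steps (1)–(5) of the context (the generalized-suffix-tree algorithm with difference arrays) computes $d_\rho(S,T)$ correctly. Moreover, assuming a linear-time suffix-tree (or suffix-array) construction, the total running time is $O(m+n)$ and the memory usage is $O(m+n)$.
   Context: $\Sigma$ is a fixed finite set of characters; $\Sigma^k$ is the set of strings of length $k$ over $\Sigma$, and $\Sigma^*=\bigsqcup_{k\ge 0}\Sigma^k$. $|S|$ denotes the length of $S$. For strings $S,X$, the multiplicity $c(S,X)$ is the number of pairs $(P_1,P_2)$ of strings with $S=P_1XP_2$. For $k\ge 1$, $[S]_k\in\mathbb{R}^{\Sigma^k}$ is the $k$-gram count vector $[S]_k(X)=c(S,X)$ for $X\in\Sigma^k$. For vectors $u,v$ with nonnegative entries, $\theta(u,v)=\arccos\left(\frac{u\cdot v}{\|u\|\|v\|}\right)$ if $u,v\ne 0$, $\theta(u,v)=0$ if $u=v=0$, and $\theta(u,v)=\pi/2$ otherwise. Set $\theta_k(S,T)=\theta([S]_k,[T]_k)$ and $d_\rho(S,T)=\sum_{k\ge 1}\rho^k\theta_k(S,T)$; one has $\theta_k(S,T)=0$ for $k>L_{\max}$, where $L_{\max}=\max(m,n)$. Aggregated quantities: $A_k(S)=\|[S]_k\|^2$, $A_k(T)=\|[T]_k\|^2$, $B_k(S,T)=[S]_k\cdot[T]_k$. Then $\theta_k(S,T)$ equals $\arccos\bigl(B_k(S,T)/\sqrt{A_k(S)A_k(T)}\bigr)$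 if $A_k(S)A_k(T)\ne0$, equals $0$ if $A_k(S)=A_k(T)=0$, and equals $\pi/2$ otherwise. Suffix-tree notation: let $\#,\$\notin\Sigma$ be two fresh terminal symbols (sentinels) and put $U=S\#T\$$. The generalized suffix tree $\mathcal T$ of $S$ and $T$ is the suffix tree of $U$ in which each leaf is labeled according to whether its suffix begins in the $S$-block or the $T$-block. For a node $v$, $\mathrm{depth}(v)$ is the length of the path label from the root to $v$; $\mathrm{occ}_S(v)$ (resp. $\mathrm{occ}_T(v)$) is the number of leaves in the subtree of $v$ whose suffix begins in $S$ (resp. $T$). For a non-root node $v$, $\ell_v^-=\mathrm{depth}(\mathrm{parent}(v))+1$, and $\ell_v^+$ is the largest integer $d\le\mathrm{depth}(v)$ such that the length-$d$ prefix of the path label to $v$ lies in $\Sigma^d$ (contains neither $\#$ nor $\$$). The algorithm: attention is restricted to nodes $v$ for which every label on the root-to-$v$ path lies in $\Sigma$ (no symbol $\#$ or $\$$ appears); nodes whose path label crosses a sentinel are ignored in the sums. (1) Build the generalized suffix tree $\mathcal T$ of $U=S\#T\$$. (2) Compute $\mathrm{occ}_S(v)$ and $\mathrm{occ}_T(v)$ for all nodes $v$ by a single post-order traversal: at a leaf, set $(\mathrm{occ}_S,\mathrm{occ}_T)=(1,0)$ or $(0,1)$ depending on its origin, and at an internal node sum the counts of its children. (3) Initialize three difference arrays $D_S,D_T,D_{ST}\in\mathbb{R}^{L_{\max}+2}$. For each non-root node $v$ whose path label lies in $\Sigma^*$, compute $a_v=\mathrm{occ}_S(v)^2$, $b_v=\mathrm{occ}_T(v)^2$,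 $c_v=\mathrm{occ}_S(v)\,\mathrm{occ}_T(v)$, and perform the range additions: add $a_v$ to $D_S[\ell_v^-]$ and subtract $a_v$ from $D_S[\ell_v^++1]$; add $b_v$ to $D_T[\ell_v^-]$ and subtract $b_v$ from $D_T[\ell_v^++1]$; add $c_v$ to $D_{ST}[\ell_v^-]$ and subtract $c_v$ from $D_{ST}[\ell_v^++1]$; ignore any indices greater than $L_{\max}+1$. (4) Convert the difference arrays to prefix sums to obtain $A_k(S)$, $A_k(T)$, $B_k(S,T)$ for $1\le k\le L_{\max}$. (5) Compute $\theta_k(S,T)$ for $1\le k\le L_{\max}$ from the formula above in terms of $A_k(S),A_k(T),B_k(S,T)$, and evaluate $d_\rho(S,T)=\sum_{k=1}^{L_{\max}}\rho^k\theta_k(S,T)$.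
   Formalization: In step (3) every non-root node v with ℓ_v^- ≤ ℓ_v^+ is used, leaves included, contributing its sentinel-free range, instead of only nodes whose whole path label lies in Σ^*; the literal version outputs 0 for S=a, T=b although d_ρ=ρπ/2. *)

theory Defs
  imports "HOL-Analysis.Analysis" "HOL-Library.Monad_Syntax"
begin

section \<open>The distance\<close>

definition multiplicity_of :: "'a list \<Rightarrow> 'a list \<Rightarrow> nat" where
  "multiplicity_of S X = card {(P1, P2). S = P1 @ X @ P2}"

definition grams :: "nat \<Rightarrow> 'a list set" where
  "grams k = {X. length X = k}"

text \<open>Vectors in \<open>\<real>\<^sup>I\<close> are functions restricted to a finite index set \<open>I\<close>;
  for \<open>k\<close>-gram vectors \<open>I = grams k\<close>, which is finite because the alphabet is a finite type.\<close>

definition gram_vec :: "'a list \<Rightarrow> 'a list \<Rightarrow> real" where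
  "gram_vec S X = real (multiplicity_of S X)"

definition dot :: "'i set \<Rightarrow> ('i \<Rightarrow> real) \<Rightarrow> ('i \<Rightarrow> real) \<Rightarrow> real" where
  "dot I u v = (\<Sum>x\<in>I. u x * v x)"

definition vnorm :: "'i set \<Rightarrow> ('i \<Rightarrow> real) \<Rightarrow> real" where
  "vnorm I u = sqrt (\<Sum>x\<in>I. (u x)\<^sup>2)"

definition is_zero :: "'i set \<Rightarrow> ('i \<Rightarrow> real) \<Rightarrow> bool" where
  "is_zero I u \<longleftrightarrow> (\<forall>x\<in>I. u x = 0)"

definition angle :: "'i set \<Rightarrow> ('i \<Rightarrow> real) \<Rightarrow> ('i \<Rightarrow> real) \<Rightarrow> real" where
  "angle I u v =
     (if \<not> is_zero I u \<and> \<not> is_zero I v then arccos (dot I u v / (vnorm I u * vnorm I v))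
      else if is_zero I u \<and> is_zero I v then 0
      else pi / 2)"

definition theta :: "nat \<Rightarrow> 'a::finite list \<Rightarrow> 'a list \<Rightarrow> real" where
  "theta k S T = angle (grams k) (gram_vec S) (gram_vec T)"

definition d_rho :: "real \<Rightarrow> 'a::finite list \<Rightarrow> 'a list \<Rightarrow> real" where
  "d_rho \<rho> S T = (\<Sum>j. \<rho> ^ Suc j * theta (Suc j) S T)"


section \<open>Suffix trees\<close>

datatype 'a sym = Chr 'a | Hash | Dollar

definition joined :: "'a list \<Rightarrow> 'a list \<Rightarrow> 'a sym list" where
  "joined S T = map Chr S @ [Hash] @ map Chr T @ [Dollar]"

text \<open>A leaf carries the (0-based) start position of its suffix.  A branch lists its outgoing
  edges \<open>(lo, hi, subtree)\<close>; the edge label is stored in two words as the slice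
  \<open>U[lo..<hi]\<close> of the text.  The type parameter is a per-node annotation.\<close>

datatype 'x stree = Leaf 'x nat | Branch 'x "(nat \<times> nat \<times> 'x stree) list"

fun ann :: "'x stree \<Rightarrow> 'x" where
  "ann (Leaf x i) = x"
| "ann (Branch x es) = x"

definition slice :: "'b list \<Rightarrow> nat \<Rightarrow> nat \<Rightarrow> 'b list" where
  "slice U lo hi = take (hi - lo) (drop lo U)"

text \<open>\<open>node_at U r p v\<close>: \<open>v\<close> is the subtree hanging from a node of \<open>r\<close> with path label \<open>p\<close>.\<close>

inductive node_at :: "'b list \<Rightarrow> 'x stree \<Rightarrow> 'b list \<Rightarrow> 'x stree \<Rightarrow> bool"
  for U :: "'b list" and r :: "'x stree" where
  root: "node_at U r [] r"
| child: "node_at U r p (Branch x es) \<Longrightarrow> (lo, hi, v) \<in> set es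
    \<Longrightarrow> node_at U r (p @ slice U lo hi) v"

text \<open>Edge labels are nonempty slices of \<open>U\<close>; siblings differ in their first character; non-root
  internal nodes branch; the leaves correspond to the suffixes of \<open>U\<close>.  (Since edge labels are
  nonempty, \<open>p \<noteq> []\<close> singles out the non-root nodes.)\<close>

definition is_suffix_tree :: "'b list \<Rightarrow> 'x stree \<Rightarrow> bool" where
  "is_suffix_tree U r \<longleftrightarrow>
     (\<exists>x es. r = Branch x es) \<and>
     (\<forall>p x es. node_at U r p (Branch x es) \<longrightarrow>
        (p \<noteq> [] \<longrightarrow> 2 \<le> length es) \<and>
        (\<forall>(lo, hi, v) \<in> set es. lo < hi \<and> hi \<le> length U) \<and>
        distinct (map (\<lambda>(lo, hi, v). U ! lo) es)) \<and>
     (\<forall>i < length U. \<exists>x. node_at U r (drop i U) (Leaf x i)) \<and>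
     (\<forall>p x i. node_at U r p (Leaf x i) \<longrightarrow> i < length U \<and> p = drop i U)"

text \<open>Every suffix ends at a leaf only if the last character occurs nowhere else.\<close>

definition terminated :: "'b list \<Rightarrow> bool" where
  "terminated U \<longleftrightarrow> U \<noteq> [] \<and> last U \<notin> set (butlast U)"


section \<open>Cost model\<close>

text \<open>Programs for a unit-cost real RAM (words hold an integer or a real; arithmetic, comparisons,
  \<open>sqrt\<close> and \<open>arccos\<close> cost one step each).  \<open>Tick c\<close> accounts for \<open>c\<close> scalar operations,
  \<open>Reserve w\<close> and \<open>Release w\<close> for \<open>w\<close> words of storage held outside of the arrays (records, stack
  frames, scalars), \<open>New n\<close> allocates a zeroed array and passes its address on.\<close>

datatype 'r prog =
    Return 'r
  | Tick nat "'r prog"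
  | Reserve nat "'r prog"
  | Release nat "'r prog"
  | New nat "nat \<Rightarrow> 'r prog"
  | Read nat nat "real \<Rightarrow> 'r prog"
  | Write nat nat real "'r prog"

primrec bind_prog :: "'r prog \<Rightarrow> ('r \<Rightarrow> 's prog) \<Rightarrow> 's prog" where
  "bind_prog (Return x) f = f x"
| "bind_prog (Tick c p) f = Tick c (bind_prog p f)"
| "bind_prog (Reserve w p) f = Reserve w (bind_prog p f)"
| "bind_prog (Release w p) f = Release w (bind_prog p f)"
| "bind_prog (New n k) f = New n (\<lambda>a. bind_prog (k a) f)"
| "bind_prog (Read a i k) f = Read a i (\<lambda>x. bind_prog (k x) f)"
| "bind_prog (Write a i x p) f = Write a i x (bind_prog p f)"

adhoc_overloading Monad_Syntax.bind \<rightleftharpoons> bind_prog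

record machine =
  arrays :: "real list list"
  steps :: nat
  live :: nat
  peak :: nat

definition initial :: machine where
  "initial = \<lparr>arrays = [], steps = 0, live = 0, peak = 0\<rparr>"

text \<open>Initialising a word costs a step.\<close>

definition charge :: "nat \<Rightarrow> machine \<Rightarrow> machine" where
  "charge c s = s\<lparr>steps := steps s + c\<rparr>"

definition occupy :: "nat \<Rightarrow> machine \<Rightarrow> machine" where
  "occupy w s = s\<lparr>steps := steps s + w, live := live s + w, peak := max (peak s) (live s + w)\<rparr>"

primrec run :: "'r prog \<Rightarrow> machine \<Rightarrow> 'r \<times> machine" where
  "run (Return x) s = (x, s)"
| "run (Tick c p) s = run p (charge c s)"
| "run (Reserve w p) s = run p (occupy w s)"
| "run (Release w p) s = run p (charge 1 (s\<lparr>live := live s - w\<rparr>))"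
| "run (New n k) s =
     run (k (length (arrays s)))
       (charge 1 (occupy n (s\<lparr>arrays := arrays s @ [replicate n 0]\<rparr>)))"
| "run (Read a i k) s = run (k (arrays s ! a ! i)) (charge 1 s)"
| "run (Write a i x p) s =
     run p (charge 1 (s\<lparr>arrays := (arrays s)[a := (arrays s ! a)[i := x]]\<rparr>))"

definition result :: "'r prog \<Rightarrow> 'r" where
  "result p = fst (run p initial)"

definition running_time :: "'r prog \<Rightarrow> nat" where
  "running_time p = steps (snd (run p initial))"

definition memory_usage :: "'r prog \<Rightarrow> nat" where
  "memory_usage p = peak (snd (run p initial))"

definition tick :: "nat \<Rightarrow> unit prog" where "tick c = Tick c (Return ())"
definition reserve :: "nat \<Rightarrow> unit prog" where "reserve w = Reserve w (Return ())"
definition release :: "nat \<Rightarrow> unit prog" where "release w = Release w (Return ())"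
definition new :: "nat \<Rightarrow> nat prog" where "new n = New n Return"
definition read_at :: "nat \<Rightarrow> nat \<Rightarrow> real prog" where "read_at a i = Read a i Return"
definition write_at :: "nat \<Rightarrow> nat \<Rightarrow> real \<Rightarrow> unit prog" where "write_at a i x = Write a i x (Return ())"

definition framed :: "'r prog \<Rightarrow> 'r prog" where
  "framed p = do { reserve 8; x \<leftarrow> p; release 8; Return x }"

text \<open>\<open>loop f n s\<close> runs \<open>f 1, \<dots>, f n\<close> in this order, threading the state \<open>s\<close>.\<close>

primrec loop :: "(nat \<Rightarrow> 's \<Rightarrow> 's prog) \<Rightarrow> nat \<Rightarrow> 's \<Rightarrow> 's prog" where
  "loop f 0 s = Return s"
| "loop f (Suc k) s = do { s' \<leftarrow> loop f k s; tick 2; f (Suc k) s' }"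

definition constructs_suffix_trees :: "('b list \<Rightarrow> unit stree prog) \<Rightarrow> bool" where
  "constructs_suffix_trees build \<longleftrightarrow>
     (\<forall>U. terminated U \<longrightarrow> is_suffix_tree U (result (build U)))"

definition linear_time :: "('b list \<Rightarrow> unit stree prog) \<Rightarrow> bool" where
  "linear_time build \<longleftrightarrow>
     (\<exists>c::nat. \<forall>U. terminated U \<longrightarrow> running_time (build U) \<le> c * length U)"


section \<open>The algorithm\<close>

subsection \<open>Occurrence counts\<close>

text \<open>Position \<open>m = length S\<close> of \<open>joined S T\<close> holds \<open>#\<close>; positions up to \<open>m\<close> form the \<open>S\<close>-block.
  (The leaves of the suffixes starting with a sentinel only affect the counts of the root and of
  themselves, which are never used.)

  Every node is charged 7 words: edge label (2), child and sibling pointers (2), suffix index (1)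
  and the two counts.  This covers the storage of the tree itself.\<close>

fun count_tree :: "nat \<Rightarrow> 'x stree \<Rightarrow> (nat \<times> nat) stree prog"
and count_edges :: "nat \<Rightarrow> (nat \<times> nat \<times> 'x stree) list
      \<Rightarrow> ((nat \<times> nat \<times> (nat \<times> nat) stree) list \<times> nat \<times> nat) prog" where
  "count_tree m (Leaf x i) = do {
     reserve 7;
     tick 2;
     Return (Leaf (if i \<le> m then (1, 0) else (0, 1)) i) }"
| "count_tree m (Branch x es) = do {
     reserve 7;
     (es', a, b) \<leftarrow> framed (count_edges m es);
     tick 2;
     Return (Branch (a, b) es') }"
| "count_edges m [] = do { tick 1; Return ([], 0, 0) }"
| "count_edges m ((lo, hi, v) # es) = do {
     v' \<leftarrow> count_tree m v;
     (es', a, b) \<leftarrow> framed (count_edges m es);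
     tick 4;
     Return ((lo, hi, v') # es', fst (ann v') + a, snd (ann v') + b) }"

subsection \<open>Range additions\<close>

text \<open>For a path label \<open>q\<close>: the largest \<open>d \<le> depth\<close> such that the prefix of length \<open>d\<close> is free of
  sentinels.\<close>

definition ell_plus :: "'a sym list \<Rightarrow> nat" where
  "ell_plus q = Max {d. d \<le> length q \<and> set (take d q) \<subseteq> range Chr}"

definition next_sentinel :: "nat \<Rightarrow> nat \<Rightarrow> nat \<Rightarrow> nat" where
  "next_sentinel m n lo = (if lo \<le> m then m else m + n + 1)"

text \<open>How \<open>ell_plus\<close> is obtained in constant time.  The path label of an internal node of the
  suffix tree of \<open>joined S T\<close> is always free of sentinels, because it occurs at least twice.\<close>

lemma ell_plus_append_slice:
  assumes p: "set p \<subseteq> range Chr"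
    and lo: "lo < hi" "hi \<le> length (joined S T)"
  shows "ell_plus (p @ slice (joined S T) lo hi) =
    length p + min (hi - lo) (next_sentinel (length S) (length T) lo - lo)"
    (is "ell_plus ?q = length p + ?e")
proof -
  let ?U = "joined S T" and ?s = "next_sentinel (length S) (length T) lo"
  have len: "length ?U = length S + length T + 2" by (simp add: joined_def)
  have len_slice: "length (slice ?U lo hi) = hi - lo" using lo by (simp add: slice_def)
  have nth_slice: "slice ?U lo hi ! j = ?U ! (lo + j)" if "j < hi - lo" for j
    using that lo by (simp add: slice_def)
  have chr: "?U ! j \<in> range Chr" if "lo \<le> j" "j < ?s" for j
    using that by (auto simp: joined_def next_sentinel_def nth_append nth_Cons split: if_splits nat.splits)
  have sen: "?U ! ?s \<notin> range Chr"
    by (auto simp: joined_def next_sentinel_def nth_append)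
  have s_ge: "lo \<le> ?s" using lo len by (auto simp: next_sentinel_def)
  have "{d. d \<le> length ?q \<and> set (take d ?q) \<subseteq> range Chr} = {..length p + ?e}"
  proof (intro set_eqI iffI)
    fix d assume "d \<in> {d. d \<le> length ?q \<and> set (take d ?q) \<subseteq> range Chr}"
    then have d: "d \<le> length p + (hi - lo)" "set (take d ?q) \<subseteq> range Chr"
      by (auto simp: len_slice)
    have "d \<le> length p + (?s - lo)"
    proof (rule ccontr)
      assume "\<not> ?thesis"
      then have lt: "length p + (?s - lo) < d" by simp
      then have "?s - lo < hi - lo" using d(1) by linarith
      then have "slice ?U lo hi ! (?s - lo) = ?U ! ?s" using nth_slice s_ge by simp
      then have "take d ?q ! (length p + (?s - lo)) = ?U ! ?s"
        using lt by (simp only: nth_take nth_append_length_plus)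
      moreover have "length p + (?s - lo) < length (take d ?q)"
        using lt d(1) by (simp add: len_slice)
      ultimately have "?U ! ?s \<in> set (take d ?q)" by (metis nth_mem)
      then show False using d(2) sen by blast
    qed
    then show "d \<in> {..length p + ?e}" using d(1) by simp
  next
    fix d assume "d \<in> {..length p + ?e}"
    then have d: "d \<le> length p + (hi - lo)" "d \<le> length p + (?s - lo)" by auto
    have "?q ! j \<in> range Chr" if "j < d" for j
    proof (cases "j < length p")
      case True
      then show ?thesis using p nth_mem by (auto simp: nth_append)
    next
      case False
      then have "?q ! j = ?U ! (lo + (j - length p))"
        using that d by (simp add: nth_append nth_slice)
      moreover have "lo + (j - length p) < ?s" using False that d by linarith
      ultimately show ?thesis using chr by simp
    qed
    then have "set (take d ?q) \<subseteq> range Chr"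
      unfolding set_conv_nth by (auto simp del: take_append)
    then show "d \<in> {d. d \<le> length ?q \<and> set (take d ?q) \<subseteq> range Chr}"
      using d(1) by (simp add: len_slice)
  qed
  moreover have "Max {..length p + ?e} = length p + ?e" by (rule Max_eqI) auto
  ultimately show ?thesis by (simp only: ell_plus_def)
qed

definition add_at :: "nat \<Rightarrow> nat \<Rightarrow> nat \<Rightarrow> real \<Rightarrow> unit prog" where
  "add_at L D i x = do {
     tick 2;
     if i \<le> L + 1 then do { y \<leftarrow> read_at D i; tick 1; write_at D i (y + x) } else Return () }"

definition range_add :: "nat \<Rightarrow> nat \<Rightarrow> nat \<Rightarrow> nat \<Rightarrow> real \<Rightarrow> unit prog" where
  "range_add L D i j x = do { tick 2; add_at L D i x; add_at L D (j + 1) (- x) }"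

text \<open>\<open>d\<close> is the depth of the parent.  Only the sentinel-free part of an edge, i.e. the lengths
  \<open>lm..lp\<close>, counts, and an edge that begins with a sentinel (\<open>lp < lm\<close>) is ignored.  Leaf edges
  always end in \<open>$\<close> but may begin with alphabet characters; that part has to be kept, since those
  are exactly the loci of substrings with a single occurrence in \<open>joined S T\<close>.  (Dropping leaf
  edges altogether would, e.g., lose all substrings for \<open>S = a\<close>, \<open>T = b\<close>.)\<close>

fun scatter_tree :: "nat \<Rightarrow> nat \<Rightarrow> nat \<Rightarrow> nat \<times> nat \<times> nat \<Rightarrow> nat \<Rightarrow> (nat \<times> nat) stree \<Rightarrow> unit prog"
and scatter_edges :: "nat \<Rightarrow> nat \<Rightarrow> nat \<Rightarrow> nat \<times> nat \<times> nat \<Rightarrow> nat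
      \<Rightarrow> (nat \<times> nat \<times> (nat \<times> nat) stree) list \<Rightarrow> unit prog" where
  "scatter_tree m n L D d (Leaf x i) = tick 1"
| "scatter_tree m n L D d (Branch x es) = do { tick 1; framed (scatter_edges m n L D d es) }"
| "scatter_edges m n L D d [] = tick 1"
| "scatter_edges m n L (DS, DT, DST) d ((lo, hi, v) # es) = do {
     tick 12;
     let (occS, occT) = ann v;
     let lm = d + 1;
     let lp = d + min (hi - lo) (next_sentinel m n lo - lo);
     (if lm \<le> lp then do {
        tick 3;
        range_add L DS lm lp (real (occS ^ 2));
        range_add L DT lm lp (real (occT ^ 2));
        range_add L DST lm lp (real (occS * occT)) }
      else Return ());
     scatter_tree m n L (DS, DT, DST) (d + (hi - lo)) v;
     framed (scatter_edges m n L (DS, DT, DST) d es) }"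

subsection \<open>Prefix sums and evaluation\<close>

definition prefix_sums :: "nat \<Rightarrow> nat \<Rightarrow> unit prog" where
  "prefix_sums L D =
     loop (\<lambda>i _. do { x \<leftarrow> read_at D (i - 1); y \<leftarrow> read_at D i; tick 2; write_at D i (x + y) }) L ()"

definition theta_of :: "real \<Rightarrow> real \<Rightarrow> real \<Rightarrow> real" where
  "theta_of A A' B =
     (if A * A' \<noteq> 0 then arccos (B / sqrt (A * A'))
      else if A = 0 \<and> A' = 0 then 0
      else pi / 2)"

text \<open>The loop state is the partial sum together with \<open>\<rho> ^ k\<close>.\<close>

definition evaluate :: "real \<Rightarrow> nat \<Rightarrow> nat \<times> nat \<times> nat \<Rightarrow> real prog" where
  "evaluate \<rho> L = (\<lambda>(DS, DT, DST). do {
     (acc, pw) \<leftarrow> loop (\<lambda>k (acc, pw). do {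
         A \<leftarrow> read_at DS k;
         A' \<leftarrow> read_at DT k;
         B \<leftarrow> read_at DST k;
         tick 11;
         Return (acc + pw * theta_of A A' B, pw * \<rho>) }) L (0, \<rho>);
     Return acc })"

text \<open>The initial reservation pays for writing down \<open>joined S T\<close> and for the scalar variables.\<close>

definition gst_algorithm ::
    "('a sym list \<Rightarrow> unit stree prog) \<Rightarrow> real \<Rightarrow> 'a list \<Rightarrow> 'a list \<Rightarrow> real prog" where
  "gst_algorithm build \<rho> S T = do {
     let m = length S;
     let n = length T;
     let L = max m n;
     reserve (m + n + 2);
     reserve 16;
     tick (m + n + 1);
     t \<leftarrow> build (joined S T);
     t' \<leftarrow> count_tree m t;
     DS \<leftarrow> new (L + 2);
     DT \<leftarrow> new (L + 2);
     DST \<leftarrow> new (L + 2);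
     scatter_tree m n L (DS, DT, DST) 0 t';
     prefix_sums L DS;
     prefix_sums L DT;
     prefix_sums L DST;
     evaluate \<rho> L (DS, DT, DST) }"

end

theory Submission
  imports Defs "HOL-Library.Sublist"
begin

text \<open>
  Correctness rests on loci.  Write \<open>U = joined S T\<close>.  A nonempty string \<open>X\<close> over the alphabet that
  occurs in \<open>U\<close> is spelled from the root of the suffix tree by a path that ends on exactly one edge,
  possibly inside it, and the leaves below this edge are the positions at which \<open>X\<close> occurs
  (\<open>sum_loci\<close>).  An occurrence of \<open>X\<close> avoids the sentinels, so it lies in \<open>S\<close> or in \<open>T\<close> according to
  the block of its start, and the two leaf counts of the edge are the multiplicities of \<open>X\<close> in \<open>S\<close> and
  \<open>T\<close> (\<open>tally_occurrences\<close>).  Conversely an edge is the locus of exactly one string over the alphabet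
  of each length \<open>k\<close> from \<open>\<ell>\<^sup>-\<close> to \<open>\<ell>\<^sup>+\<close>, and of none of any other length (\<open>sum_grams_on_edge\<close>).
  Summing over the edges whose range contains \<open>k\<close> is therefore summing over the \<open>k\<close>-grams
  (\<open>sum_additions\<close>).  That the constant-time formula for \<open>\<ell>\<^sup>+\<close> applies is due to
  \<open>branch_path_sentinel_free\<close>: the path label of an inner node occurs twice in \<open>U\<close>, which a string
  with a sentinel does not.  Prefix sums of the difference arrays turn the range additions into these
  sums (\<open>sum_fold_add_range\<close>), and lengths beyond \<open>max (length S) (length T)\<close> contribute nothing to
  the series.

  For the running time, leaves correspond to the suffixes of \<open>U\<close> and inner nodes branch, so the tree
  has at most twice as many edges as \<open>U\<close> has characters (\<open>edges_le_leaves\<close>).  Each edge costs a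
  bounded number of steps in both traversals, and the loops over the arrays are linear.  The
  construction runs while no array has been allocated, and a program sees nothing of the machine but
  its arrays (\<open>run_arrays_determine\<close>), so inside of the algorithm it returns the same tree and takes
  the same time as on its own.  Finally, occupying a word costs a step, so the peak memory never
  exceeds the number of steps (\<open>memory_usage_le_running_time\<close>).
\<close>

section \<open>Evaluation of programs\<close>

lemma run_bind:
  "run (bind_prog p f) s = (case run p s of (x, s') \<Rightarrow> run (f x) s')"
  by (induction p arbitrary: s) auto

text \<open>Control flow depends on the arrays only: the counters for steps and storage are never read.  Hence
  the number of steps taken does not depend on what was executed before.\<close>

lemma run_arrays_determine:
  fixes s s' :: machine
  assumes "arrays s = arrays s'"
  shows "fst (run p s) = fst (run p s') \<and> arrays (snd (run p s)) = arrays (snd (run p s'))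
    \<and> steps (snd (run p s)) + steps s' = steps (snd (run p s')) + steps s"
  using assms
proof (induction p arbitrary: s s')
  case (Tick c p)
  have "arrays (charge c s) = arrays (charge c s')" using Tick.prems by (simp add: charge_def)
  from Tick.IH[OF this] show ?case by (simp add: charge_def)
next
  case (Reserve w p)
  have "arrays (occupy w s) = arrays (occupy w s')" using Reserve.prems by (simp add: occupy_def)
  from Reserve.IH[OF this] show ?case by (simp add: occupy_def)
next
  case (Release w p)
  have "arrays (charge 1 (s\<lparr>live := live s - w\<rparr>)) = arrays (charge 1 (s'\<lparr>live := live s' - w\<rparr>))"
    using Release.prems by (simp add: charge_def)
  from Release.IH[OF this] show ?case by (simp add: charge_def)
next
  case (New n k)
  let ?t = "\<lambda>s. charge 1 (occupy n (s\<lparr>arrays := arrays s @ [replicate n 0]\<rparr>))"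
  have "arrays (?t s) = arrays (?t s')"
    using New.prems by (simp add: charge_def occupy_def)
  from New.IH[OF rangeI this] New.prems show ?case by (simp add: charge_def occupy_def)
next
  case (Read a i k)
  have "arrays (charge 1 s) = arrays (charge 1 s')" using Read.prems by (simp add: charge_def)
  from Read.IH[OF rangeI this] Read.prems show ?case by (simp add: charge_def)
next
  case (Write a i x p)
  let ?t = "\<lambda>s. charge 1 (s\<lparr>arrays := (arrays s)[a := (arrays s ! a)[i := x]]\<rparr>)"
  have "arrays (?t s) = arrays (?t s')" using Write.prems by (simp add: charge_def)
  from Write.IH[OF this] Write.prems show ?case by (simp add: charge_def)
qed simp

text \<open>Every word that is occupied is paid for by a step, so both storage counters stay below the step
  counter.\<close>

lemma run_peak_le_steps:
  fixes s :: machine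
  assumes "live s \<le> steps s" "peak s \<le> steps s"
  shows "live (snd (run p s)) \<le> steps (snd (run p s)) \<and> peak (snd (run p s)) \<le> steps (snd (run p s))"
  using assms
  by (induction p arbitrary: s) (simp_all add: charge_def occupy_def)

corollary memory_usage_le_running_time: "memory_usage p \<le> running_time p"
  unfolding memory_usage_def running_time_def
  using run_peak_le_steps[of initial p] by (simp add: initial_def)

text \<open>A big-step judgement with a cost bound: from the arrays \<open>A\<close> the program \<open>p\<close> yields the value \<open>x\<close>
  and the arrays \<open>A'\<close> within \<open>c\<close> steps.  One derivation, guided by the syntax of the program,
  establishes its result and its running time together.\<close>

definition evals :: "'r prog \<Rightarrow> real list list \<Rightarrow> 'r \<Rightarrow> real list list \<Rightarrow> nat \<Rightarrow> bool" where
  "evals p A x A' c \<longleftrightarrow> (\<forall>s :: machine. arrays s = A \<longrightarrow>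
     fst (run p s) = x \<and> arrays (snd (run p s)) = A' \<and> steps (snd (run p s)) \<le> steps s + c)"

text \<open>Derivations produce values and costs in the shape dictated by the program; this rule replaces them
  by the intended ones afterwards.\<close>

lemma evals_conv:
  assumes "evals p A x A' c" "x = y" "A' = B" "c \<le> d"
  shows "evals p A y B d"
  unfolding evals_def
proof (intro allI impI)
  fix s :: machine assume "arrays s = A"
  from assms(1)[unfolded evals_def, rule_format, OF this] assms(2-)
  show "fst (run p s) = y \<and> arrays (snd (run p s)) = B \<and> steps (snd (run p s)) \<le> steps s + d"
    by simp
qed

lemma evals_Return: "evals (Return x) A x A 0"
  by (simp add: evals_def)

lemma evals_bind:
  assumes "evals p A x A' c" "evals (f x) A' y A'' d"
  shows "evals (bind_prog p f) A y A'' (c + d)"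
  unfolding evals_def
proof (intro allI impI)
  fix s :: machine assume "arrays s = A"
  then have p: "fst (run p s) = x" "arrays (snd (run p s)) = A'" "steps (snd (run p s)) \<le> steps s + c"
    using assms(1) by (auto simp: evals_def)
  then have "fst (run (f x) (snd (run p s))) = y \<and> arrays (snd (run (f x) (snd (run p s)))) = A''
      \<and> steps (snd (run (f x) (snd (run p s)))) \<le> steps (snd (run p s)) + d"
    using assms(2) by (simp add: evals_def)
  moreover have "run (bind_prog p f) s = run (f x) (snd (run p s))"
    using p(1) by (auto simp: run_bind split: prod.split)
  ultimately show "fst (run (bind_prog p f) s) = y \<and> arrays (snd (run (bind_prog p f) s)) = A''
      \<and> steps (snd (run (bind_prog p f) s)) \<le> steps s + (c + d)"
    using p(3) by simp
qed

lemma evals_tick: "evals (tick c) A () A c"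
  by (simp add: evals_def tick_def charge_def)

lemma evals_reserve: "evals (reserve w) A () A w"
  by (simp add: evals_def reserve_def occupy_def)

lemma evals_release: "evals (release w) A () A 1"
  by (simp add: evals_def release_def charge_def)

lemma evals_new: "evals (new n) A (length A) (A @ [replicate n 0]) (n + 1)"
  by (simp add: evals_def new_def charge_def occupy_def)

lemma evals_read_at: "evals (read_at a i) A (A ! a ! i) A 1"
  by (simp add: evals_def read_at_def charge_def)

lemma evals_write_at: "evals (write_at a i x) A () (A[a := (A ! a)[i := x]]) 1"
  by (simp add: evals_def write_at_def charge_def)

lemmas evals_intros = evals_Return evals_tick evals_reserve evals_release evals_new
  evals_read_at evals_write_at evals_bind

lemma evals_framed:
  assumes "evals p A x A' c"
  shows "evals (framed p) A x A' (c + 9)"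
  unfolding framed_def
  by (rule evals_conv, (rule evals_intros assms)+) simp_all

lemma evals_loop:
  assumes "\<And>k. k < n \<Longrightarrow> evals (f (Suc k) (\<sigma> k)) (\<alpha> k) (\<sigma> (Suc k)) (\<alpha> (Suc k)) c"
  shows "evals (loop f n (\<sigma> 0)) (\<alpha> 0) (\<sigma> n) (\<alpha> n) (n * (c + 2))"
  using assms
proof (induction n)
  case 0
  then show ?case using evals_Return[of "\<sigma> 0"] by simp
next
  case (Suc n)
  then have "evals (loop f n (\<sigma> 0)) (\<alpha> 0) (\<sigma> n) (\<alpha> n) (n * (c + 2))" by simp
  note 1 = this and 2 = Suc.prems[of n]
  show ?case
    unfolding loop.simps by (rule evals_conv, (rule evals_intros 1 2)+) simp_all
qed

text \<open>A program that is embedded in a larger one before any array has been allocated behaves as if it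
  were run alone, no matter how many steps and words have been used up already.\<close>

lemma evals_from_initial:
  "evals p [] (result p) (arrays (snd (run p initial))) (running_time p)"
  unfolding evals_def
proof (intro allI impI)
  fix s :: machine assume "arrays s = []"
  then have "arrays s = arrays initial" by (simp add: initial_def)
  from run_arrays_determine[OF this, of p]
  show "fst (run p s) = result p \<and> arrays (snd (run p s)) = arrays (snd (run p initial))
      \<and> steps (snd (run p s)) \<le> steps s + running_time p"
    by (simp add: result_def running_time_def initial_def)
qed

lemma result_and_time_of_evals:
  assumes "evals p [] x A c"
  shows "result p = x" "running_time p \<le> c"
  using assms[unfolded evals_def, rule_format, of initial]
  by (simp_all add: result_def running_time_def initial_def)

section \<open>Trees and leaf counts\<close>

fun leaves :: "'x stree \<Rightarrow> nat list" where
  "leaves (Leaf x i) = [i]"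
| "leaves (Branch x es) = concat (map (\<lambda>(lo, hi, v). leaves v) es)"

text \<open>An edge is recorded together with the path label \<open>p\<close> of its upper end, so that the strings that
  end on it can be read off.  There is one edge per non-root node.\<close>

fun edges :: "'b list \<Rightarrow> 'b list \<Rightarrow> 'x stree \<Rightarrow> ('b list \<times> nat \<times> nat \<times> 'x stree) list" where
  "edges U p (Leaf x i) = []"
| "edges U p (Branch x es) =
     concat (map (\<lambda>(lo, hi, v). (p, lo, hi, v) # edges U (p @ slice U lo hi) v) es)"

text \<open>The conditions of \<open>is_suffix_tree\<close> on the nodes, recast by recursion over the tree with the path
  label \<open>p\<close> of the current node as a parameter.  This form is inherited by subtrees and so supports
  structural induction, which the global formulation through \<open>node_at\<close> does not.\<close>

fun wf_tree :: "'b list \<Rightarrow> 'b list \<Rightarrow> 'x stree \<Rightarrow> bool" where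
  "wf_tree U p (Leaf x i) \<longleftrightarrow> i < length U \<and> p = drop i U"
| "wf_tree U p (Branch x es) \<longleftrightarrow>
     (p \<noteq> [] \<longrightarrow> 2 \<le> length es) \<and>
     distinct (map (\<lambda>(lo, hi, v). U ! lo) es) \<and>
     (\<forall>(lo, hi, v) \<in> set es. lo < hi \<and> hi \<le> length U \<and> wf_tree U (p @ slice U lo hi) v)"

text \<open>The generated induction rule refers to the children through the set functions of products; this
  form speaks of the members of the edge list.\<close>

lemma stree_induct [case_names Leaf Branch]:
  fixes t :: "'x stree"
  assumes "\<And>x i. P (Leaf x i)"
    and "\<And>x es. (\<And>lo hi v. (lo, hi, v) \<in> set es \<Longrightarrow> P v) \<Longrightarrow> P (Branch x es)"
  shows "P t"
  by (induction t) (fastforce intro: assms)+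

lemma length_edges_Branch:
  "length (edges U p (Branch x es)) = (\<Sum>(lo, hi, v) \<leftarrow> es. Suc (length (edges U (p @ slice U lo hi) v)))"
  unfolding edges.simps length_concat map_map
  by (rule arg_cong[where f = sum_list], rule map_cong) auto

definition tally :: "nat \<Rightarrow> nat list \<Rightarrow> nat \<times> nat" where
  "tally m is = (length (filter (\<lambda>i. i \<le> m) is), length (filter (\<lambda>i. m < i) is))"

fun annotate :: "nat \<Rightarrow> 'x stree \<Rightarrow> (nat \<times> nat) stree" where
  "annotate m (Leaf x i) = Leaf (tally m [i]) i"
| "annotate m (Branch x es) = Branch (tally m (leaves (Branch x es)))
     (map (\<lambda>(lo, hi, v). (lo, hi, annotate m v)) es)"

lemma ann_annotate: "ann (annotate m t) = tally m (leaves t)"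
  by (cases t) auto

text \<open>The additive constant covers the root; the factor 32 covers one tree call together with the
  surrounding step through an edge list.\<close>

lemma evals_count_tree:
  "evals (count_tree m t) A (annotate m t) A (32 * length (edges U p t) + 19)"
proof (induction t arbitrary: p rule: stree_induct)
  case (Leaf x i)
  show ?case
    unfolding count_tree.simps
    by (rule evals_conv, (rule evals_intros)+) (auto simp: tally_def)
next
  case (Branch x es)
  have edges: "evals (count_edges m es') A
      (map (\<lambda>(lo, hi, v). (lo, hi, annotate m v)) es', tally m (concat (map (\<lambda>(lo, hi, v). leaves v) es')))
      A (32 * (\<Sum>(lo, hi, v) \<leftarrow> es'. Suc (length (edges U (p @ slice U lo hi) v))) + 1)"
    if "set es' \<subseteq> set es" for es'
    using that
  proof (induction es')
    case Nil
    show ?case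
      unfolding count_edges.simps
      by (rule evals_conv, (rule evals_intros)+) (auto simp: tally_def)
  next
    case (Cons e es')
    obtain lo hi v where e: "e = (lo, hi, v)" by (cases e)
    have "(lo, hi, v) \<in> set es" using Cons.prems e by simp
    note v = Branch.IH[OF this, of "p @ slice U lo hi"]
    have es': "evals (count_edges m es') A
      (map (\<lambda>(lo, hi, v). (lo, hi, annotate m v)) es', tally m (concat (map (\<lambda>(lo, hi, v). leaves v) es')))
      A (32 * (\<Sum>(lo, hi, v) \<leftarrow> es'. Suc (length (edges U (p @ slice U lo hi) v))) + 1)"
      using Cons by simp
    show ?case
      unfolding e count_edges.simps
      by (rule evals_conv, rule evals_bind[OF v evals_bind[OF evals_framed[OF es']]],
          simp only: tally_def split, (rule evals_intros)+)
        (simp_all add: ann_annotate tally_def)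
  qed
  from edges[OF order_refl] show ?case
    unfolding length_edges_Branch count_tree.simps
    by - (rule evals_conv, rule evals_bind[OF evals_reserve evals_bind[OF evals_framed]], assumption,
        simp only: tally_def split, (rule evals_intros)+, simp_all add: tally_def)
qed

section \<open>Difference arrays\<close>

definition bump :: "nat \<Rightarrow> real \<Rightarrow> real list \<Rightarrow> real list" where
  "bump i x xs = xs[i := xs ! i + x]"

definition add_range :: "nat \<times> nat \<times> real \<Rightarrow> real list \<Rightarrow> real list" where
  "add_range = (\<lambda>(i, j, x). bump (Suc j) (- x) \<circ> bump i x)"

text \<open>The range additions \<open>(i, j, x)\<close> caused by a list of edges in one of the three tables; the weight \<open>w\<close>
  selects the table.  Empty ranges, which belong to edges that start with a sentinel, are dropped.\<close>

definition additions :: "nat \<Rightarrow> nat \<Rightarrow> (nat \<times> nat \<Rightarrow> real) \<Rightarrow> ('b list \<times> nat \<times> nat \<times> 'x stree) list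
    \<Rightarrow> (nat \<times> nat \<times> real) list" where
  "additions m n w es = filter (\<lambda>(i, j, x). i \<le> j)
     (map (\<lambda>(p, lo, hi, v). (Suc (length p),
        length p + min (hi - lo) (next_sentinel m n lo - lo), w (tally m (leaves v)))) es)"

lemma length_bump [simp]: "length (bump i x xs) = length xs"
  by (simp add: bump_def)

lemma length_add_range [simp]: "length (add_range r xs) = length xs"
  by (simp add: add_range_def split: prod.split)

lemma length_fold_add_range [simp]: "length (fold add_range rs xs) = length xs"
  by (induction rs arbitrary: xs) simp_all

text \<open>An index beyond the end of the table is ignored by the program, and a list update outside of the
  list is the identity, so the same expression describes both cases.\<close>

lemma evals_add_at:
  assumes "length (A ! D) = L + 2"
  shows "evals (add_at L D i x) A () (A[D := bump i x (A ! D)]) 5"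
proof (cases "i \<le> L + 1")
  case True
  then show ?thesis
    unfolding add_at_def if_P[OF True]
    by (intro evals_conv[OF evals_bind[OF evals_tick evals_bind[OF evals_read_at
          evals_bind[OF evals_tick evals_write_at]]]]) (simp_all add: bump_def)
next
  case False
  with assms have "bump i x (A ! D) = A ! D" by (simp add: bump_def list_update_beyond)
  then show ?thesis
    unfolding add_at_def if_not_P[OF False]
    by (intro evals_conv[OF evals_bind[OF evals_tick evals_Return]]) simp_all
qed

lemma evals_range_add:
  assumes "D < length A" "length (A ! D) = L + 2"
  shows "evals (range_add L D i j x) A () (A[D := add_range (i, j, x) (A ! D)]) 12"
  unfolding range_add_def
  by (rule evals_conv, rule evals_bind[OF evals_tick evals_bind[OF evals_add_at evals_add_at]])
    (use assms in \<open>simp_all add: add_range_def\<close>)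

definition tables_ok :: "nat \<Rightarrow> nat \<times> nat \<times> nat \<Rightarrow> real list list \<Rightarrow> bool" where
  "tables_ok L = (\<lambda>(DS, DT, DST) A. distinct [DS, DT, DST] \<and>
     (\<forall>D \<in> {DS, DT, DST}. D < length A \<and> length (A ! D) = L + 2))"

text \<open>The effect of the scatter phase on the store.\<close>

definition add_ranges :: "nat \<Rightarrow> nat \<Rightarrow> nat \<times> nat \<times> nat \<Rightarrow> ('b list \<times> nat \<times> nat \<times> 'x stree) list
    \<Rightarrow> real list list \<Rightarrow> real list list" where
  "add_ranges m n = (\<lambda>(DS, DT, DST) es A. A
     [DS := fold add_range (additions m n (\<lambda>(a, b). real (a ^ 2)) es) (A ! DS),
      DT := fold add_range (additions m n (\<lambda>(a, b). real (b ^ 2)) es) (A ! DT),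
      DST := fold add_range (additions m n (\<lambda>(a, b). real (a * b)) es) (A ! DST)])"

lemma tables_ok_add_ranges:
  assumes "tables_ok L Ds A"
  shows "tables_ok L Ds (add_ranges m n Ds es A)"
proof -
  obtain DS DT DST where Ds: "Ds = (DS, DT, DST)" by (cases Ds)
  show ?thesis
    using assms unfolding Ds by (simp add: tables_ok_def add_ranges_def nth_list_update)
qed

lemma additions_append: "additions m n w (es @ es') = additions m n w es @ additions m n w es'"
  by (simp add: additions_def)

lemma add_ranges_append:
  assumes "tables_ok L Ds A"
  shows "add_ranges m n Ds (es @ es') A = add_ranges m n Ds es' (add_ranges m n Ds es A)"
proof -
  obtain DS DT DST where Ds: "Ds = (DS, DT, DST)" by (cases Ds)
  have overwrite: "A[i := x, j := y, k := z, i := x', j := y', k := z'] = A[i := x', j := y', k := z']"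
    if "i < length A" "j < length A" "k < length A" for A :: "real list list" and i j k x y z x' y' z'
    by (rule nth_equalityI) (use that in \<open>simp_all add: nth_list_update\<close>)
  show ?thesis
    using assms unfolding Ds
    by (simp add: tables_ok_def add_ranges_def additions_append overwrite)
qed

lemma add_ranges_Nil: "add_ranges m n Ds [] A = A"
  by (cases Ds) (simp add: add_ranges_def additions_def)

lemma evals_add_edge:
  fixes p :: "'b list" and v :: "'x stree" and m n lo hi :: nat
  assumes "tables_ok L (DS, DT, DST) A" and d: "d = length p" and tally: "tally m (leaves v) = (a, b)"
  defines "lm \<equiv> d + 1" and "lp \<equiv> d + min (hi - lo) (next_sentinel m n lo - lo)"
  shows "evals (if lm \<le> lp then do {
        tick 3;
        range_add L DS lm lp (real (a ^ 2));
        range_add L DT lm lp (real (b ^ 2));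
        range_add L DST lm lp (real (a * b)) }
      else Return ()) A () (add_ranges m n (DS, DT, DST) [(p, lo, hi, v)] A) 39"
proof (cases "lm \<le> lp")
  case True
  then have additions: "additions m n w [(p, lo, hi, v)] = [(lm, lp, w (tally m (leaves v)))]" for w
    unfolding additions_def lm_def lp_def d by (simp del: min_less_iff_conj)
  have ok: "DS \<noteq> DT" "DS \<noteq> DST" "DT \<noteq> DST" "DS < length A" "DT < length A" "DST < length A"
    "length (A ! DS) = L + 2" "length (A ! DT) = L + 2" "length (A ! DST) = L + 2"
    using assms(1) by (auto simp: tables_ok_def)
  show ?thesis
    unfolding if_P[OF True]
  proof (rule evals_conv, rule evals_bind[OF evals_tick evals_bind[OF evals_range_add
          evals_bind[OF evals_range_add evals_range_add]]])
  qed (simp_all add: ok add_ranges_def additions tally)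
next
  case False
  then have "additions m n w [(p, lo, hi, v)] = []" for w
    unfolding additions_def lm_def lp_def d by (simp del: min_less_iff_conj)
  then show ?thesis
    unfolding if_not_P[OF False]
    by (intro evals_conv[OF evals_Return]) (simp_all add: add_ranges_def)
qed

text \<open>The traversal keeps only depths; since edge labels are genuine slices of \<open>U\<close>, the depth is the
  length of the path label.  The factor 71 is 60 for a step through an edge list (12 for the
  arithmetic, 39 for the three range additions, 9 for the stack frame) plus 11 for the call on the
  subtree.\<close>

lemma evals_scatter_tree:
  assumes "wf_tree U p t" "tables_ok L Ds A"
  shows "evals (scatter_tree m n L Ds (length p) (annotate m t)) A ()
    (add_ranges m n Ds (edges U p t) A) (71 * length (edges U p t) + 11)"
  using assms
proof (induction t arbitrary: p A rule: stree_induct)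
  case (Leaf x i)
  show ?case
    unfolding annotate.simps scatter_tree.simps
    by (rule evals_conv[OF evals_tick]) (simp_all add: add_ranges_Nil)
next
  case (Branch x es)
  obtain DS DT DST where Ds: "Ds = (DS, DT, DST)" by (cases Ds)
  let ?edges = "\<lambda>es. edges U p (Branch x es)"
  have edges: "evals (scatter_edges m n L Ds (length p) (map (\<lambda>(lo, hi, v). (lo, hi, annotate m v)) es')) A ()
      (add_ranges m n Ds (?edges es') A) (71 * length (?edges es') + 1)"
    if "set es' \<subseteq> set es" "tables_ok L Ds A" for es' A
    using that
  proof (induction es' arbitrary: A)
    case Nil
    show ?case
      unfolding list.map Ds scatter_edges.simps
      by (rule evals_conv[OF evals_tick]) (simp_all add: add_ranges_Nil)
  next
    case (Cons e es')
    obtain lo hi v where e: "e = (lo, hi, v)" by (cases e)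
    have mem: "(lo, hi, v) \<in> set es" using Cons.prems e by simp
    then have wf: "lo < hi" "hi \<le> length U" "wf_tree U (p @ slice U lo hi) v"
      using Branch.prems(1) by auto
    then have len: "length (p @ slice U lo hi) = length p + (hi - lo)" by (simp add: slice_def)
    let ?A1 = "add_ranges m n Ds [(p, lo, hi, v)] A"
    let ?A2 = "add_ranges m n Ds (edges U (p @ slice U lo hi) v) ?A1"
    have ok: "tables_ok L Ds ?A1" "tables_ok L Ds ?A2"
      using Cons.prems(2) by (simp_all add: tables_ok_add_ranges)
    have 1: "evals (scatter_tree m n L Ds (length p + (hi - lo)) (annotate m v)) ?A1 () ?A2
        (71 * length (edges U (p @ slice U lo hi) v) + 11)"
      using Branch.IH[OF mem wf(3) ok(1)] by (simp only: len)
    have 2: "evals (scatter_edges m n L Ds (length p) (map (\<lambda>(lo, hi, v). (lo, hi, annotate m v)) es'))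
        ?A2 () (add_ranges m n Ds (?edges es') ?A2) (71 * length (?edges es') + 1)"
      by (rule Cons.IH[OF _ ok(2)]) (use Cons.prems(1) in simp)
    have split: "?edges (e # es') = [(p, lo, hi, v)] @ edges U (p @ slice U lo hi) v @ ?edges es'"
      by (simp add: e)
    have arr: "add_ranges m n Ds (?edges es') ?A2 = add_ranges m n Ds (?edges (e # es')) A"
      unfolding split by (simp only: add_ranges_append[OF Cons.prems(2)] add_ranges_append[OF ok(1)])
    obtain a b where ab: "tally m (leaves v) = (a, b)" by (cases "tally m (leaves v)")
    show ?case
      unfolding e list.map prod.case Ds scatter_edges.simps ann_annotate ab Let_def
      by (rule evals_conv, rule evals_bind, rule evals_tick, rule evals_bind,
          rule evals_add_edge[OF Cons.prems(2)[unfolded Ds] refl ab, where lo = lo and hi = hi],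
          rule evals_bind, rule 1[unfolded Ds], rule evals_framed, rule 2[unfolded Ds])
        (use arr split in \<open>simp_all add: Ds e\<close>)
  qed
  from edges[OF order_refl Branch.prems(2)] show ?case
    unfolding annotate.simps scatter_tree.simps
    by - (rule evals_conv, rule evals_bind[OF evals_tick evals_framed], assumption, simp_all)
qed

lemma sum_bump:
  "k < length xs \<Longrightarrow> (\<Sum>l\<le>k. bump i x xs ! l) = (\<Sum>l\<le>k. xs ! l) + (if i \<le> k then x else 0)"
proof -
  assume "k < length xs"
  then have "(\<Sum>l\<le>k. bump i x xs ! l) = (\<Sum>l\<le>k. xs ! l + (if l = i then x else 0))"
    by (intro sum.cong) (auto simp: bump_def nth_list_update)
  then show ?thesis by (simp add: sum.distrib sum.delta)
qed

text \<open>The principle of difference arrays: adding \<open>x\<close> at \<open>i\<close> and subtracting it at \<open>j + 1\<close> raises exactly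
  the prefix sums at \<open>i..j\<close>.\<close>

lemma sum_fold_add_range:
  assumes "k < length xs" "\<forall>(i, j, x) \<in> set rs. i \<le> j"
  shows "(\<Sum>l\<le>k. fold add_range rs xs ! l) =
    (\<Sum>l\<le>k. xs ! l) + (\<Sum>(i, j, x) \<leftarrow> rs. if i \<le> k \<and> k \<le> j then x else 0)"
  using assms
proof (induction rs arbitrary: xs)
  case (Cons r rs)
  obtain i j x where r: "r = (i, j, x)" by (cases r)
  have "(\<Sum>l\<le>k. add_range r xs ! l) = (\<Sum>l\<le>k. xs ! l) + (if i \<le> k \<and> k \<le> j then x else 0)"
    using Cons.prems by (auto simp: r add_range_def sum_bump)
  then show ?case using Cons by (simp add: r)
qed simp

text \<open>The table after \<open>n\<close> rounds of the in-place prefix summation; the entries after position \<open>n\<close> still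
  hold their original values.\<close>

definition accumulated :: "nat \<Rightarrow> real list \<Rightarrow> real list" where
  "accumulated n xs = map (\<lambda>k. if k \<le> n then \<Sum>l\<le>k. xs ! l else xs ! k) [0..<length xs]"

lemma evals_prefix_sums:
  assumes "D < length A" "length (A ! D) = L + 2"
  shows "evals (prefix_sums L D) A () (A[D := accumulated L (A ! D)]) (7 * L)"
proof -
  let ?\<alpha> = "\<lambda>k. A[D := accumulated k (A ! D)]"
  have 0: "?\<alpha> 0 = A"
  proof -
    have "accumulated 0 (A ! D) = A ! D"
      by (rule nth_equalityI) (auto simp: accumulated_def simp del: upt_Suc)
    then show ?thesis by simp
  qed
  have step: "evals (do { x \<leftarrow> read_at D (Suc k - 1); y \<leftarrow> read_at D (Suc k); tick 2; write_at D (Suc k) (x + y) })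
      (?\<alpha> k) () (?\<alpha> (Suc k)) 5" if "k < L" for k
  proof (rule evals_conv, rule evals_bind, rule evals_read_at, rule evals_bind, rule evals_read_at,
      rule evals_bind, rule evals_tick, rule evals_write_at)
    show "(?\<alpha> k) [D := (?\<alpha> k ! D) [Suc k := ?\<alpha> k ! D ! (Suc k - 1) + ?\<alpha> k ! D ! Suc k]] = ?\<alpha> (Suc k)"
    proof -
      have "(accumulated k (A ! D)) [Suc k := accumulated k (A ! D) ! k + accumulated k (A ! D) ! Suc k]
          = accumulated (Suc k) (A ! D)"
        using assms(2) that
        by (intro nth_equalityI) (auto simp: accumulated_def nth_list_update simp del: upt_Suc)
      then show ?thesis using assms(1) by simp
    qed
  qed simp_all
  show ?thesis
    unfolding prefix_sums_def
    using evals_loop[of L "\<lambda>i _. do { x \<leftarrow> read_at D (i - 1); y \<leftarrow> read_at D i; tick 2; write_at D i (x + y) }"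
        "\<lambda>_. ()" ?\<alpha> 5, OF step] by (simp add: 0 mult.commute)
qed

lemma evals_evaluate:
  "evals (evaluate \<rho> L (DS, DT, DST)) A
     (\<Sum>k = 1..L. \<rho> ^ k * theta_of (A ! DS ! k) (A ! DT ! k) (A ! DST ! k)) A (16 * L)"
proof -
  let ?\<sigma> = "\<lambda>n. (\<Sum>k = 1..n. \<rho> ^ k * theta_of (A ! DS ! k) (A ! DT ! k) (A ! DST ! k), \<rho> ^ Suc n)"
  let ?body = "\<lambda>k (acc, pw). do {
         A \<leftarrow> read_at DS k;
         A' \<leftarrow> read_at DT k;
         B \<leftarrow> read_at DST k;
         tick 11;
         Return (acc + pw * theta_of A A' B, pw * \<rho>) }"
  have step: "evals (?body (Suc n) (?\<sigma> n)) A (?\<sigma> (Suc n)) A 14" for n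
    unfolding prod.case
    by (rule evals_conv, (rule evals_intros)+) simp_all
  have "evals (loop ?body L (?\<sigma> 0)) A (?\<sigma> L) A (L * (14 + 2))"
    by (rule evals_loop[where \<alpha> = "\<lambda>_. A"]) (rule step)
  then have loop: "evals (loop ?body L (0, \<rho>)) A (?\<sigma> L) A (16 * L)"
    by (simp add: mult.commute)
  show ?thesis
    unfolding evaluate_def prod.case
    by (rule evals_conv, rule evals_bind, rule loop, unfold prod.case, rule evals_Return) simp_all
qed

section \<open>Leaves and edges of a suffix tree\<close>

lemma slice_Cons: "lo < hi \<Longrightarrow> hi \<le> length U \<Longrightarrow> slice U lo hi = U ! lo # slice U (Suc lo) hi"
  by (simp add: slice_def Cons_nth_drop_Suc[symmetric] take_Cons')

lemma prefix_snocD: "prefix (p @ [c]) Z \<Longrightarrow> Z ! length p = c"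
  by (auto simp: prefix_def nth_append)

lemma wf_tree_subtree:
  "node_at U r p v \<Longrightarrow> is_suffix_tree U r \<Longrightarrow> wf_tree U p v"
proof (induction v arbitrary: p rule: stree_induct)
  case (Leaf x i)
  have "\<forall>p x i. node_at U r p (Leaf x i) \<longrightarrow> i < length U \<and> p = drop i U"
    using Leaf.prems(2) unfolding is_suffix_tree_def by (elim conjE)
  from this[rule_format, OF Leaf.prems(1)] show ?case by simp
next
  case (Branch x es)
  have "(p \<noteq> [] \<longrightarrow> 2 \<le> length es) \<and> (\<forall>(lo, hi, v) \<in> set es. lo < hi \<and> hi \<le> length U) \<and>
      distinct (map (\<lambda>(lo, hi, v). U ! lo) es)"
  proof -
    have "\<forall>p x es. node_at U r p (Branch x es) \<longrightarrow>
        (p \<noteq> [] \<longrightarrow> 2 \<le> length es) \<and> (\<forall>(lo, hi, v) \<in> set es. lo < hi \<and> hi \<le> length U) \<and>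
        distinct (map (\<lambda>(lo, hi, v). U ! lo) es)"
      using Branch.prems(2) unfolding is_suffix_tree_def by (elim conjE)
    from this[THEN spec, THEN spec, THEN spec, THEN mp, OF Branch.prems(1)] show ?thesis .
  qed
  moreover have "wf_tree U (p @ slice U lo hi) v" if "(lo, hi, v) \<in> set es" for lo hi v
    by (rule Branch.IH[OF that node_at.child[OF Branch.prems(1) that] Branch.prems(2)])
  ultimately show ?case by auto
qed

lemma leaves_node_at: "node_at U r p v \<Longrightarrow> set (leaves v) \<subseteq> set (leaves r)"
proof (induction rule: node_at.induct)
  case (child p x es lo hi v)
  from child.hyps(2) have "set (leaves v) \<subseteq> set (leaves (Branch x es))" by force
  with child.IH show ?case by (rule order_trans[rotated])
qed simp

lemma leaf_has_prefix:
  "wf_tree U p t \<Longrightarrow> i \<in> set (leaves t) \<Longrightarrow> i < length U \<and> prefix p (drop i U)"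
proof (induction t arbitrary: p rule: stree_induct)
  case (Branch x es)
  then obtain lo hi v where v: "(lo, hi, v) \<in> set es" "i \<in> set (leaves v)" by auto
  with Branch.prems(1) have "wf_tree U (p @ slice U lo hi) v" by auto
  from Branch.IH[OF v(1) this v(2)] show ?case
    using append_prefixD[of p "slice U lo hi" "drop i U"] by simp
qed auto

text \<open>All leaves below an edge continue the path label with the first character of the edge.  As siblings
  differ in this character, they have no leaf in common.\<close>

lemma leaf_first_char:
  assumes "wf_tree U p (Branch x es)" "(lo, hi, v) \<in> set es" "i \<in> set (leaves v)"
  shows "drop i U ! length p = U ! lo"
proof -
  have "lo < hi" "hi \<le> length U" "wf_tree U (p @ slice U lo hi) v" using assms by auto
  with leaf_has_prefix[OF this(3) assms(3)] have "prefix ((p @ [U ! lo]) @ slice U (Suc lo) hi) (drop i U)"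
    by (simp add: slice_Cons)
  then show ?thesis by (rule prefix_snocD[OF append_prefixD])
qed

lemma distinct_leaves: "wf_tree U p t \<Longrightarrow> distinct (leaves t)"
proof (induction t arbitrary: p rule: stree_induct)
  case (Branch x es)
  have "distinct (concat (map (\<lambda>(lo, hi, v). leaves v) es'))"
    if "set es' \<subseteq> set es" "distinct (map (\<lambda>(lo, hi, v). U ! lo) es')" for es'
    using that
  proof (induction es')
    case (Cons e es')
    obtain lo hi v where e: "e = (lo, hi, v)" by (cases e)
    with Cons.prems have mem: "(lo, hi, v) \<in> set es" by simp
    then have "distinct (leaves v)" using Branch by auto
    moreover have sep: False
      if "i \<in> set (leaves v)" "i \<in> set (leaves v')" "(lo', hi', v') \<in> set es'" for i lo' hi' v'
    proof -
      have "(lo', hi', v') \<in> set es" using that(3) Cons.prems(1) by auto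
      then have "U ! lo = U ! lo'"
        using leaf_first_char[OF Branch.prems] mem that(1,2) by metis
      then show False using Cons.prems(2) that(3) by (force simp: e)
    qed
    moreover have "distinct (concat (map (\<lambda>(lo, hi, v). leaves v) es'))"
      using Cons by simp
    moreover have "set (leaves v) \<inter> set (concat (map (\<lambda>(lo, hi, v). leaves v) es')) = {}"
      using sep by auto
    ultimately show ?case by (simp add: e)
  qed simp
  then show ?case using Branch.prems by simp
qed simp

text \<open>A non-root inner node has at least two children, which accounts for the slack of 2 away from the
  root: with \<open>e\<^sub>i + 2 \<le> 2 * l\<^sub>i\<close> for each of \<open>c \<ge> 2\<close> children, the sum of all \<open>e\<^sub>i + 1\<close> is at most
  \<open>2 * l - c\<close>.\<close>

lemma edges_le_leaves:
  "wf_tree U p t \<Longrightarrow> length (edges U p t) + (if p = [] then 0 else 2) \<le> 2 * length (leaves t)"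
proof (induction t arbitrary: p rule: stree_induct)
  case (Branch x es)
  have "length (edges U p (Branch x es')) + length es' \<le> 2 * length (leaves (Branch x es'))"
    if "set es' \<subseteq> set es" for es'
    using that
  proof (induction es')
    case (Cons e es')
    obtain lo hi v where e: "e = (lo, hi, v)" by (cases e)
    with Cons.prems have mem: "(lo, hi, v) \<in> set es" by simp
    then have "slice U lo hi \<noteq> []" using Branch.prems by (auto simp: slice_Cons)
    then have "length (edges U (p @ slice U lo hi) v) + 2 \<le> 2 * length (leaves v)"
      using Branch.IH[OF mem, of "p @ slice U lo hi"] Branch.prems mem by auto
    then show ?case using Cons by (simp add: e)
  qed simp
  from this[OF order_refl] show ?case using Branch.prems by auto
qed simp

lemma set_leaves_suffix_tree:
  assumes "is_suffix_tree U r"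
  shows "set (leaves r) = {..<length U}"
proof
  show "set (leaves r) \<subseteq> {..<length U}"
    using leaf_has_prefix[OF wf_tree_subtree[OF node_at.root assms]] by blast
  show "{..<length U} \<subseteq> set (leaves r)"
  proof
    fix i assume "i \<in> {..<length U}"
    moreover have "\<forall>i < length U. \<exists>x. node_at U r (drop i U) (Leaf x i)"
      using assms unfolding is_suffix_tree_def by (elim conjE)
    ultimately obtain x where "node_at U r (drop i U) (Leaf x i)" by auto
    from leaves_node_at[OF this] show "i \<in> set (leaves r)" by simp
  qed
qed

text \<open>Every edge leaves an inner node that is well-formed in its own right and lies below the start.\<close>

lemma edge_origin:
  "wf_tree U q t \<Longrightarrow> (p, lo, hi, v) \<in> set (edges U q t) \<Longrightarrow>
    prefix q p \<and> (\<exists>x es. wf_tree U p (Branch x es) \<and> (lo, hi, v) \<in> set es)"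
proof (induction t arbitrary: q rule: stree_induct)
  case (Branch x es)
  then obtain lo' hi' v' where e: "(lo', hi', v') \<in> set es"
    "(p, lo, hi, v) = (q, lo', hi', v') \<or> (p, lo, hi, v) \<in> set (edges U (q @ slice U lo' hi') v')"
    by auto
  from e(2) show ?case
  proof
    assume "(p, lo, hi, v) = (q, lo', hi', v')"
    then show ?thesis using Branch.prems(1) e(1) by auto
  next
    assume "(p, lo, hi, v) \<in> set (edges U (q @ slice U lo' hi') v')"
    moreover have "wf_tree U (q @ slice U lo' hi') v'" using Branch.prems(1) e(1) by auto
    ultimately have "prefix (q @ slice U lo' hi') p \<and> (\<exists>x es. wf_tree U p (Branch x es) \<and> (lo, hi, v) \<in> set es)"
      using Branch.IH[OF e(1)] by blast
    then show ?thesis using append_prefixD[of q "slice U lo' hi'" p] by blast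
  qed
qed simp

section \<open>The locus of a string\<close>

text \<open>The string \<open>Y\<close> ends on the edge: strictly below its upper end and not beyond its lower end.\<close>

definition on_edge :: "'b list \<Rightarrow> 'b list \<Rightarrow> 'b list \<times> nat \<times> nat \<times> 'x stree \<Rightarrow> bool" where
  "on_edge U Y = (\<lambda>(p, lo, hi, v). length p < length Y \<and> prefix Y (p @ slice U lo hi))"

lemma on_edge_below:
  assumes "wf_tree U q t" "e \<in> set (edges U q t)" "on_edge U Y e"
  shows "strict_prefix q Y"
proof -
  obtain p lo hi v where e: "e = (p, lo, hi, v)" by (cases e)
  have qp: "prefix q p" using edge_origin[OF assms(1)] assms(2) e by blast
  have Y: "length p < length Y" "prefix Y (p @ slice U lo hi)"
    using assms(3) by (auto simp: e on_edge_def)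
  then have "prefix p Y" using prefix_length_prefix[of p "p @ slice U lo hi" Y] by simp
  with qp have "prefix q Y" by (rule prefix_order.order_trans)
  moreover have "q \<noteq> Y" using prefix_length_le[OF qp] Y(1) by auto
  ultimately show ?thesis by (simp add: strict_prefix_def)
qed

lemma sum_list_neutral: "\<forall>x \<in> set xs. x = (0 :: real) \<Longrightarrow> sum_list xs = 0"
  by (induction xs) auto

text \<open>If the keys \<open>g\<close> are distinct and only the key \<open>c\<close> carries a nonempty list, then at most one summand
  is nonzero, and a function that is not additive may nevertheless be moved across the concatenation.\<close>

lemma sum_list_single_contribution:
  assumes "f [] = (0 :: real)" "distinct (map g es)" "\<And>e. e \<in> set es \<Longrightarrow> N e \<noteq> [] \<Longrightarrow> g e = c"
  shows "(\<Sum>e \<leftarrow> es. f (N e)) = f (concat (map N es))"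
  using assms(2,3)
proof (induction es)
  case (Cons e es)
  show ?case
  proof (cases "N e = []")
    case True
    then show ?thesis using Cons assms(1) by simp
  next
    case False
    then have "g e = c" using Cons.prems by simp
    have "N e' = []" if "e' \<in> set es" for e'
    proof (rule ccontr)
      assume "N e' \<noteq> []"
      then have "g e' = g e" using Cons.prems(2) that \<open>g e = c\<close> by simp
      then show False using Cons.prems(1) that by (metis distinct.simps(2) imageI list.simps(9) set_map)
    qed
    then have "concat (map N es) = []" "(\<Sum>e \<leftarrow> es. f (N e)) = 0"
      using assms(1) by (auto intro!: sum_list_neutral)
    then show ?thesis by (simp del: concat_eq_Nil_conv)
  qed
qed (use assms(1) in simp)

text \<open>Below a proper prefix of \<open>Y\<close>, at most one edge is the locus of \<open>Y\<close>, and its leaves are all leaves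
  whose suffixes start with \<open>Y\<close>; if there is no locus, there is no such leaf either and both sides
  vanish.  In the induction, \<open>Y\<close> either passes through an edge, or ends on it, or departs from it, and
  only the edge that starts with the next character of \<open>Y\<close> can be of the first two kinds.\<close>

lemma sum_loci:
  fixes w :: "nat \<times> nat \<Rightarrow> real"
  assumes "wf_tree U p t" "strict_prefix p Y" and w: "w (0, 0) = 0"
  shows "(\<Sum>e \<leftarrow> edges U p t. if on_edge U Y e then w (tally m (leaves (snd (snd (snd e))))) else 0)
    = w (tally m (filter (\<lambda>i. prefix Y (drop i U)) (leaves t)))"
  using assms(1,2)
proof (induction t arbitrary: p rule: stree_induct)
  case (Leaf x i)
  then have "\<not> prefix Y (drop i U)" by (auto simp: strict_prefix_def intro: prefix_order.antisym)
  then show ?case using w by (simp add: tally_def)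
next
  case (Branch x es)
  let ?g = "\<lambda>e. if on_edge U Y e then w (tally m (leaves (snd (snd (snd e))))) else 0"
  let ?N = "\<lambda>v. filter (\<lambda>i. prefix Y (drop i U)) (leaves v)"
  have edge: "?g (p, lo, hi, v) + sum_list (map ?g (edges U (p @ slice U lo hi) v)) = w (tally m (?N v))"
    if mem: "(lo, hi, v) \<in> set es" for lo hi v
  proof -
    let ?q = "p @ slice U lo hi"
    have wf: "wf_tree U ?q v" using Branch.prems(1) mem by auto
    consider "strict_prefix ?q Y" | "prefix Y ?q" | "\<not> prefix ?q Y" "\<not> prefix Y ?q"
      by (auto simp: strict_prefix_def)
    then show ?thesis
    proof cases
      \<comment> \<open>\<open>Y\<close> passes through the edge.\<close>
      case 1
      then have "\<not> on_edge U Y (p, lo, hi, v)"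
        by (auto simp: on_edge_def strict_prefix_def intro: prefix_order.antisym)
      then show ?thesis using Branch.IH[OF mem wf 1] by simp
    next
      \<comment> \<open>\<open>Y\<close> ends on the edge, so every leaf below it continues \<open>Y\<close> and no deeper edge is a locus.\<close>
      case 2
      have "length p < length Y" using Branch.prems(2) by (rule prefix_length_less)
      then have on: "on_edge U Y (p, lo, hi, v)" using 2 by (simp add: on_edge_def)
      have "\<not> on_edge U Y e" if "e \<in> set (edges U ?q v)" for e
        using on_edge_below[OF wf that] 2 by (auto simp: strict_prefix_def intro: prefix_order.antisym)
      then have "sum_list (map ?g (edges U ?q v)) = 0" by (intro sum_list_neutral) auto
      moreover have "?N v = leaves v"
        using leaf_has_prefix[OF wf] by (intro filter_True ballI prefix_order.order_trans[OF 2]) simp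
      ultimately show ?thesis using on by simp
    next
      \<comment> \<open>\<open>Y\<close> departs from the edge or from its upper end.\<close>
      case 3
      then have "\<not> on_edge U Y (p, lo, hi, v)" by (simp add: on_edge_def)
      moreover have "\<not> on_edge U Y e" if "e \<in> set (edges U ?q v)" for e
        using on_edge_below[OF wf that] 3 by (auto simp: strict_prefix_def)
      then have "sum_list (map ?g (edges U ?q v)) = 0" by (intro sum_list_neutral) auto
      moreover have "?N v = []"
        unfolding filter_empty_conv
      proof (intro ballI notI)
        fix i assume "i \<in> set (leaves v)" "prefix Y (drop i U)"
        with leaf_has_prefix[OF wf] 3 prefix_same_cases[of ?q "drop i U" Y] show False by simp
      qed
      ultimately show ?thesis using w by (simp add: tally_def)
    qed
  qed
  have "sum_list (map ?g (edges U p (Branch x es)))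
      = (\<Sum>e \<leftarrow> es. w (tally m (?N (snd (snd e)))))"
  proof -
    have "sum_list (map ?g (edges U p (Branch x es'))) = (\<Sum>e \<leftarrow> es'. w (tally m (?N (snd (snd e)))))"
      if "set es' \<subseteq> set es" for es'
      using that
    proof (induction es')
      case (Cons e es')
      obtain lo hi v where e: "e = (lo, hi, v)" by (cases e)
      have "(lo, hi, v) \<in> set es" using Cons.prems e by simp
      from edge[OF this] Cons show ?case by (simp add: e)
    qed simp
    from this[OF order_refl] show ?thesis .
  qed
  also have "\<dots> = w (tally m (concat (map (\<lambda>e. ?N (snd (snd e))) es)))"
  proof (rule sum_list_single_contribution[where g = "\<lambda>(lo, hi, v). U ! lo" and c = "Y ! length p"])
    fix e assume e: "e \<in> set es" "?N (snd (snd e)) \<noteq> []"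
    then obtain i where i: "i \<in> set (leaves (snd (snd e)))" "prefix Y (drop i U)"
      by (auto simp: filter_empty_conv)
    have "drop i U ! length p = U ! fst e"
      using leaf_first_char[OF Branch.prems(1), of "fst e" "fst (snd e)" "snd (snd e)"] e(1) i(1) by simp
    moreover have "drop i U ! length p = Y ! length p"
      using i(2) prefix_length_less[OF Branch.prems(2)] by (auto simp: prefix_def nth_append)
    ultimately show "(case e of (lo, hi, v) \<Rightarrow> U ! lo) = Y ! length p"
      by (simp add: case_prod_beta)
  qed (use Branch.prems(1) w in \<open>simp_all add: tally_def\<close>)
  also have "concat (map (\<lambda>e. ?N (snd (snd e))) es) = ?N (Branch x es)"
    by (simp add: filter_concat comp_def case_prod_beta)
  finally show ?case .
qed

section \<open>Leaves as occurrences in the two strings\<close>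

text \<open>A decomposition of \<open>S\<close> around \<open>X\<close> is determined by the length of its left part.\<close>

lemma multiplicity_of_eq_card_positions:
  assumes "X \<noteq> []"
  shows "multiplicity_of S X = card {i. i < length S \<and> prefix X (drop i S)}"
  unfolding multiplicity_of_def
proof (rule bij_betw_same_card[where f = "\<lambda>(P1, P2). length P1"], rule bij_betw_imageI)
  show "inj_on (\<lambda>(P1, P2). length P1) {(P1, P2). S = P1 @ X @ P2}"
    by (auto simp: inj_on_def)
  show "(\<lambda>(P1, P2). length P1) ` {(P1, P2). S = P1 @ X @ P2} = {i. i < length S \<and> prefix X (drop i S)}"
  proof (intro equalityI subsetI)
    fix i assume i: "i \<in> {i. i < length S \<and> prefix X (drop i S)}"
    then obtain P2 where "drop i S = X @ P2" by (auto simp: prefix_def)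
    then have "S = take i S @ X @ P2" by (metis append_take_drop_id)
    with i show "i \<in> (\<lambda>(P1, P2). length P1) ` {(P1, P2). S = P1 @ X @ P2}"
      by (intro image_eqI[where x = "(take i S, P2)"]) auto
  qed (use assms in auto)
qed

lemma multiplicity_of_long: "length S < length X \<Longrightarrow> multiplicity_of S X = 0"
proof -
  assume "length S < length X"
  then have "{(P1, P2). S = P1 @ X @ P2} = {}" by auto
  then show ?thesis by (simp only: multiplicity_of_def card.empty)
qed

lemma prefix_map_Chr_before_sentinel:
  "z \<notin> range Chr \<Longrightarrow> prefix (map Chr X) (map Chr Y @ z # Z) \<longleftrightarrow> prefix X Y"
proof (induction X arbitrary: Y)
  case (Cons x X)
  then show ?case by (cases Y) auto
qed simp

lemma sentinels_not_Chr [simp]: "Hash \<notin> range Chr" "Dollar \<notin> range Chr"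
  by auto

lemma drop_joined_S:
  "i \<le> length S \<Longrightarrow> drop i (joined S T) = map Chr (drop i S) @ Hash # map Chr T @ [Dollar]"
  by (simp add: joined_def drop_map)

lemma drop_joined_T:
  "j \<le> length T \<Longrightarrow> drop (length S + 1 + j) (joined S T) = map Chr (drop j T) @ [Dollar]"
  by (simp add: joined_def drop_map)

lemma length_joined: "length (joined S T) = length S + length T + 2"
  by (simp add: joined_def)

text \<open>An occurrence that starts in the \<open>S\<close>-block cannot run across \<open>#\<close>, and one that starts in the
  \<open>T\<close>-block cannot run across \<open>$\<close>, so restricting to one block counts the occurrences in one string.\<close>

lemma tally_occurrences:
  assumes tree: "is_suffix_tree (joined S T) r" and X: "X \<noteq> []"
  shows "tally (length S) (filter (\<lambda>i. prefix (map Chr X) (drop i (joined S T))) (leaves r))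
    = (multiplicity_of S X, multiplicity_of T X)"
proof -
  let ?U = "joined S T" and ?m = "length S"
  have count: "length (filter P (filter Q (leaves r))) = card {i. i < length ?U \<and> P i \<and> Q i}" for P Q
  proof -
    have "distinct (leaves r)" by (rule distinct_leaves[OF wf_tree_subtree[OF node_at.root tree]])
    then have "length (filter (\<lambda>i. P i \<and> Q i) (leaves r)) = card ({i. P i \<and> Q i} \<inter> set (leaves r))"
      by (rule distinct_length_filter)
    also have "{i. P i \<and> Q i} \<inter> set (leaves r) = {i. i < length ?U \<and> P i \<and> Q i}"
      by (auto simp: set_leaves_suffix_tree[OF tree])
    finally show ?thesis by (simp add: conj_commute)
  qed
  have "{i. i < length ?U \<and> i \<le> ?m \<and> prefix (map Chr X) (drop i ?U)}
      = {i. i < ?m \<and> prefix X (drop i S)}"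
  proof -
    have "prefix (map Chr X) (drop i ?U) \<longleftrightarrow> prefix X (drop i S)" if "i \<le> ?m" for i
      unfolding drop_joined_S[OF that] by (simp add: prefix_map_Chr_before_sentinel)
    moreover have "i < ?m" if "prefix X (drop i S)" for i
      using that X by (cases "i < ?m") auto
    ultimately have "i < length ?U \<and> i \<le> ?m \<and> prefix (map Chr X) (drop i ?U)
        \<longleftrightarrow> i < ?m \<and> prefix X (drop i S)" for i
      unfolding length_joined by (metis less_imp_le_nat trans_less_add1)
    then show ?thesis by simp
  qed
  moreover have "{i. i < length ?U \<and> ?m < i \<and> prefix (map Chr X) (drop i ?U)}
      = (\<lambda>j. ?m + 1 + j) ` {j. j < length T \<and> prefix X (drop j T)}"
  proof (intro equalityI subsetI)
    fix i assume i: "i \<in> {i. i < length ?U \<and> ?m < i \<and> prefix (map Chr X) (drop i ?U)}"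
    then obtain j where j: "i = ?m + 1 + j" using less_iff_Suc_add by auto
    with i have "j \<le> length T" by (simp add: length_joined)
    with i have "prefix (map Chr X) (map Chr (drop j T) @ [Dollar])"
      unfolding j by (simp only: drop_joined_T mem_Collect_eq)
    then have pre: "prefix X (drop j T)"
      by (rule prefix_map_Chr_before_sentinel[THEN iffD1, rotated]) simp
    with X have "j < length T" by (cases "j < length T") auto
    with pre j show "i \<in> (\<lambda>j. ?m + 1 + j) ` {j. j < length T \<and> prefix X (drop j T)}" by blast
  next
    fix i assume "i \<in> (\<lambda>j. ?m + 1 + j) ` {j. j < length T \<and> prefix X (drop j T)}"
    then obtain j where j: "i = ?m + 1 + j" "j < length T" "prefix X (drop j T)" by blast
    have "prefix (map Chr X) (drop i ?U)"
      unfolding j(1) drop_joined_T[OF less_imp_le[OF j(2)]]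
      by (rule prefix_map_Chr_before_sentinel[THEN iffD2]) (use j(3) in simp_all)
    with j show "i \<in> {i. i < length ?U \<and> ?m < i \<and> prefix (map Chr X) (drop i ?U)}"
      by (simp add: length_joined)
  qed
  then have "card {i. i < length ?U \<and> ?m < i \<and> prefix (map Chr X) (drop i ?U)}
      = card {j. j < length T \<and> prefix X (drop j T)}"
    by (simp add: card_image inj_on_def)
  ultimately show ?thesis
    by (simp only: tally_def count multiplicity_of_eq_card_positions[OF X])
qed

lemma joined_sentinel_unique:
  assumes "i < length (joined S T)" "j < length (joined S T)"
    "joined S T ! i = joined S T ! j" "joined S T ! i \<notin> range Chr"
  shows "i = j"
  using assms
  by (auto simp: joined_def nth_append nth_Cons less_Suc_eq split: if_splits nat.splits)

lemma terminated_joined: "terminated (joined S T)"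
  by (auto simp: terminated_def joined_def butlast_append)

text \<open>The path label of a branching node is a prefix of two different suffixes.  A sentinel in it would
  occur at two different positions, but each sentinel occurs only once.\<close>

lemma branch_path_sentinel_free:
  assumes "wf_tree (joined S T) p (Branch x es)"
  shows "set p \<subseteq> range Chr"
proof (cases "p = []")
  case False
  let ?U = "joined S T" and ?ls = "leaves (Branch x es)"
  \<comment> \<open>The two children give two edges, and \<open>edges_le_leaves\<close> then enforces a second leaf.\<close>
  have "2 \<le> length (edges ?U p (Branch x es))"
  proof -
    have "2 \<le> length es" using assms False by simp
    also have "length es \<le> length (edges ?U p (Branch x es))"
      unfolding length_edges_Branch by (induction es) auto
    finally show ?thesis .
  qed
  then have "4 \<le> 2 * length ?ls" using edges_le_leaves[OF assms] False
    by (simp del: leaves.simps edges.simps)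
  then have two: "0 < length ?ls" "1 < length ?ls" by linarith+
  have "?ls ! 0 \<noteq> ?ls ! 1"
    unfolding nth_eq_iff_index_eq[OF distinct_leaves[OF assms] two] by simp
  with two obtain i j where ij: "i \<noteq> j" "i \<in> set ?ls" "j \<in> set ?ls"
    using nth_mem by blast
  have occ: "l + t < length ?U \<and> ?U ! (l + t) = p ! t" if "l \<in> set ?ls" "t < length p" for l t
  proof -
    have "l < length ?U" "prefix p (drop l ?U)" using leaf_has_prefix[OF assms that(1)] by auto
    then obtain Z where Z: "drop l ?U = p @ Z" by (auto simp: prefix_def)
    have "length ?U - l = length p + length Z" using arg_cong[OF Z, of length] by simp
    moreover have "?U ! (l + t) = p ! t"
      using arg_cong[OF Z, of "\<lambda>xs. xs ! t"] \<open>l < length ?U\<close> that(2) by (simp add: nth_append)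
    ultimately show ?thesis using that(2) \<open>l < length ?U\<close> by linarith
  qed
  show ?thesis
  proof (rule subsetI, rule ccontr)
    fix c assume "c \<in> set p" "c \<notin> range Chr"
    then obtain t where t: "t < length p" "p ! t \<notin> range Chr" by (metis in_set_conv_nth)
    have "i + t = j + t"
      using occ[OF ij(2) t(1)] occ[OF ij(3) t(1)] t(2) by (intro joined_sentinel_unique[of _ S T]) auto
    with ij(1) show False by simp
  qed
qed simp

section \<open>From edges to the aggregated quantities\<close>

text \<open>Being free of sentinels is inherited by prefixes, so the lengths admitted in \<open>ell_plus\<close> form an
  initial segment.\<close>

lemma le_ell_plus_iff: "k \<le> ell_plus q \<longleftrightarrow> k \<le> length q \<and> set (take k q) \<subseteq> range Chr"
proof -
  let ?A = "{d. d \<le> length q \<and> set (take d q) \<subseteq> range Chr}"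
  have A: "finite ?A" "0 \<in> ?A" by auto
  show ?thesis
  proof
    assume "k \<le> ell_plus q"
    then have "k \<le> Max ?A" by (simp only: ell_plus_def)
    moreover have "Max ?A \<in> ?A" using A by (intro Max_in) auto
    ultimately obtain d where "k \<le> d" "d \<in> ?A" by blast
    then show "k \<le> length q \<and> set (take k q) \<subseteq> range Chr"
      using set_take_subset_set_take[of k d q] by auto
  next
    assume "k \<le> length q \<and> set (take k q) \<subseteq> range Chr"
    then show "k \<le> ell_plus q" unfolding ell_plus_def using A(1) by (intro Max_ge) auto
  qed
qed

lemma finite_grams: "finite (grams k :: 'a::finite list set)"
  using finite_lists_length_eq[of "UNIV :: 'a set" k] by (simp add: grams_def)

lemma prefix_iff_take: "prefix xs ys \<longleftrightarrow> length xs \<le> length ys \<and> take (length xs) ys = xs"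
  by (metis append_eq_conv_conj prefix_def prefix_length_le take_is_prefix)

text \<open>The only candidate is the prefix of length \<open>k\<close> of the path label to the lower end; it is a
  string over the alphabet if and only if \<open>k \<le> \<ell>\<^sup>+\<close>.\<close>

lemma sum_grams_on_edge:
  fixes c :: real
  shows "(\<Sum>X \<in> grams k. if on_edge U (map Chr (X :: 'a::finite list)) (p, lo, hi, v) then c else 0)
    = (if length p < k \<and> k \<le> ell_plus (p @ slice U lo hi) then c else 0)"
proof -
  define q where "q = p @ slice U lo hi"
  have on: "on_edge U (map Chr X) (p, lo, hi, v)
      \<longleftrightarrow> length p < k \<and> k \<le> length q \<and> take k q = map Chr X" if "X \<in> grams k" for X
    using that unfolding on_edge_def prod.case q_def[symmetric] prefix_iff_take
    by (auto simp: grams_def)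
  show ?thesis
  proof (cases "length p < k \<and> k \<le> ell_plus q")
    case True
    then have k: "length p < k" "k \<le> length q" "set (take k q) \<subseteq> range Chr"
      by (auto simp: le_ell_plus_iff)
    have "\<exists>X. take k q = map Chr X"
      unfolding ex_map_conv using k(3) by blast
    then obtain X where X: "take k q = map Chr X" by blast
    have "length X = length (take k q)" unfolding X by simp
    then have "length X = k" using k(2) by simp
    then have "X \<in> grams k" by (simp add: grams_def)
    have "(\<Sum>Z \<in> grams k. if on_edge U (map Chr Z) (p, lo, hi, v) then c else 0)
        = (\<Sum>Z \<in> grams k. if Z = X then c else 0)"
      using k(1,2) X by (intro sum.cong refl) (auto simp: on inj_map_eq_map inj_def)
    also have "\<dots> = c" using \<open>X \<in> grams k\<close> by (simp add: finite_grams)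
    finally show ?thesis using True unfolding q_def by simp
  next
    case False
    have "\<not> on_edge U (map Chr X) (p, lo, hi, v)" if "X \<in> grams k" for X
    proof
      assume "on_edge U (map Chr X) (p, lo, hi, v)"
      then have "length p < k" "k \<le> length q" "set (take k q) \<subseteq> range Chr"
        using on[OF that] by auto
      with False show False by (simp add: le_ell_plus_iff)
    qed
    then have "(\<Sum>X \<in> grams k. if on_edge U (map Chr X) (p, lo, hi, v) then c else 0) = 0"
      by (intro sum.neutral) auto
    then show ?thesis using False unfolding q_def by auto
  qed
qed

lemma sum_list_sum_swap:
  fixes f :: "'e \<Rightarrow> 'b \<Rightarrow> real"
  shows "(\<Sum>e \<leftarrow> es. \<Sum>x \<in> A. f e x) = (\<Sum>x \<in> A. \<Sum>e \<leftarrow> es. f e x)"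
  by (induction es) (simp_all add: sum.distrib)

text \<open>Double counting of the pairs of an edge and a \<open>k\<close>-gram that ends on it.\<close>

lemma sum_additions:
  fixes S T :: "'a::finite list"
  assumes tree: "is_suffix_tree (joined S T) r" and w: "w (0, 0) = (0 :: real)" and k: "0 < k"
  shows "(\<Sum>(i, j, x) \<leftarrow> additions (length S) (length T) w (edges (joined S T) [] r).
      if i \<le> k \<and> k \<le> j then x else 0)
    = (\<Sum>X \<in> grams k. w (multiplicity_of S X, multiplicity_of T X))"
proof -
  let ?U = "joined S T" and ?m = "length S" and ?n = "length T"
  let ?w = "\<lambda>e. w (tally ?m (leaves (snd (snd (snd e)))))"
  have wf: "wf_tree ?U [] r" by (rule wf_tree_subtree[OF node_at.root tree])
  have "(\<Sum>(i, j, x) \<leftarrow> additions ?m ?n w es. if i \<le> k \<and> k \<le> j then x else 0)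
      = (\<Sum>e \<leftarrow> es. \<Sum>X \<in> grams k. if on_edge ?U (map Chr (X :: 'a list)) e then ?w e else 0)"
    if "set es \<subseteq> set (edges ?U [] r)" for es
    using that
  proof (induction es)
    case (Cons e es)
    obtain p lo hi v where e: "e = (p, lo, hi, v)" by (cases e)
    have "(p, lo, hi, v) \<in> set (edges ?U [] r)" using Cons.prems by (simp add: e)
    from edge_origin[OF wf this]
    obtain x es' where es': "wf_tree ?U p (Branch x es')" "(lo, hi, v) \<in> set es'" by blast
    then have "lo < hi" "hi \<le> length ?U" by auto
    from ell_plus_append_slice[OF branch_path_sentinel_free[OF es'(1)] this]
    have ell: "ell_plus (p @ slice ?U lo hi) = length p + min (hi - lo) (next_sentinel ?m ?n lo - lo)" .
    define M where "M = min (hi - lo) (next_sentinel ?m ?n lo - lo)"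
    have "(\<Sum>(i, j, x) \<leftarrow> additions ?m ?n w [e]. if i \<le> k \<and> k \<le> j then x else 0)
        = (if length p < k \<and> k \<le> length p + M then ?w e else 0)"
      by (auto simp: additions_def e simp flip: M_def)
    also have "\<dots> = (\<Sum>X \<in> grams k. if on_edge ?U (map Chr (X :: 'a list)) e then ?w e else 0)"
      unfolding e sum_grams_on_edge ell M_def ..
    finally show ?case
      using Cons additions_append[of ?m ?n w "[e]" es] by simp
  qed (simp add: additions_def)
  from this[OF order_refl]
  have "(\<Sum>(i, j, x) \<leftarrow> additions ?m ?n w (edges ?U [] r). if i \<le> k \<and> k \<le> j then x else 0)
      = (\<Sum>e \<leftarrow> edges ?U [] r. \<Sum>X \<in> grams k. if on_edge ?U (map Chr (X :: 'a list)) e then ?w e else 0)" .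
  also have "\<dots> = (\<Sum>X \<in> grams k. \<Sum>e \<leftarrow> edges ?U [] r. if on_edge ?U (map Chr (X :: 'a list)) e then ?w e else 0)"
    by (rule sum_list_sum_swap)
  also have "\<dots> = (\<Sum>X \<in> grams k. w (multiplicity_of S X, multiplicity_of T X))"
  proof (rule sum.cong[OF refl])
    fix X :: "'a list" assume "X \<in> grams k"
    then have X: "X \<noteq> []" using k by (auto simp: grams_def)
    then have "strict_prefix [] (map Chr X)" by (simp add: strict_prefix_def)
    from sum_loci[where w = w, OF wf this w, of ?m] tally_occurrences[OF tree X]
    show "(\<Sum>e \<leftarrow> edges ?U [] r. if on_edge ?U (map Chr X) e then ?w e else 0)
        = w (multiplicity_of S X, multiplicity_of T X)" by simp
  qed
  finally show ?thesis .
qed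

lemma accumulated_additions:
  fixes S T :: "'a::finite list"
  assumes "is_suffix_tree (joined S T) r" "w (0, 0) = (0 :: real)" "0 < k" "k \<le> L"
  shows "accumulated L (fold add_range (additions (length S) (length T) w (edges (joined S T) [] r))
      (replicate (L + 2) 0)) ! k
    = (\<Sum>X \<in> grams k. w (multiplicity_of S X, multiplicity_of T X))"
proof -
  let ?rs = "additions (length S) (length T) w (edges (joined S T) [] r)"
  have "(\<Sum>l\<le>k. fold add_range ?rs (replicate (L + 2) 0) ! l)
      = (\<Sum>l\<le>k. replicate (L + 2) 0 ! l) + (\<Sum>(i, j, x) \<leftarrow> ?rs. if i \<le> k \<and> k \<le> j then x else 0)"
    using assms(4) by (intro sum_fold_add_range) (auto simp: additions_def)
  moreover have "(\<Sum>l\<le>k. replicate (L + 2) 0 ! l) = (0 :: real)"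
    using assms(4) by (intro sum.neutral) (auto simp del: replicate.simps)
  ultimately show ?thesis
    using assms(4) sum_additions[where w = w, OF assms(1-3)]
    by (simp add: accumulated_def del: upt_Suc replicate.simps)
qed

lemma theta_eq_theta_of:
  fixes S T :: "'a::finite list"
  shows "theta k S T = theta_of (\<Sum>X \<in> grams k. real (multiplicity_of S X ^ 2))
    (\<Sum>X \<in> grams k. real (multiplicity_of T X ^ 2))
    (\<Sum>X \<in> grams k. real (multiplicity_of S X * multiplicity_of T X))"
proof -
  have zero: "is_zero (grams k) (gram_vec Z) \<longleftrightarrow> (\<Sum>X \<in> grams k. real (multiplicity_of Z X ^ 2)) = 0"
    for Z :: "'a list"
    by (simp add: is_zero_def gram_vec_def sum_nonneg_eq_0_iff[OF finite_grams])
  show ?thesis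
    unfolding theta_def angle_def theta_of_def zero
    by (simp add: dot_def vnorm_def gram_vec_def real_sqrt_mult)
qed

lemma theta_long:
  fixes S T :: "'a::finite list"
  assumes "max (length S) (length T) < k"
  shows "theta k S T = 0"
proof -
  have "multiplicity_of S X = 0" "multiplicity_of T X = 0" if "X \<in> grams k" for X
    using that assms by (auto simp: grams_def intro: multiplicity_of_long)
  then show ?thesis by (simp add: theta_def angle_def is_zero_def gram_vec_def)
qed

lemma d_rho_eq_sum:
  "d_rho \<rho> S T = (\<Sum>k = 1..max (length S) (length T). \<rho> ^ k * theta k S T)"
proof -
  have "d_rho \<rho> S T = (\<Sum>j<max (length S) (length T). \<rho> ^ Suc j * theta (Suc j) S T)"
    unfolding d_rho_def by (rule suminf_finite) (auto intro!: theta_long)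
  then show ?thesis by (simp only: One_nat_def sum.atLeast1_atMost_eq)
qed

section \<open>The algorithm\<close>

text \<open>The store evolves through \<open>A0\<close> (left by the construction), \<open>A1\<close> (tables allocated), \<open>A2\<close> (ranges
  scattered) and \<open>A3\<close> to \<open>A5\<close> (one table after the other summed up).  The constant 500 is generous:
  the costs outside of the construction are at most \<open>248 * N + 470\<close> for \<open>N = length S + length T \<ge> 2\<close>.\<close>

lemma evals_gst_algorithm:
  fixes S T :: "'a::finite list"
  assumes tree: "is_suffix_tree (joined S T) (result (build (joined S T)))"
    and nonempty: "S \<noteq> []" "T \<noteq> []"
  shows "\<exists>A. evals (gst_algorithm build \<rho> S T) [] (d_rho \<rho> S T) A
    (running_time (build (joined S T)) + 500 * (length S + length T))"
proof -
  let ?U = "joined S T" and ?m = "length S" and ?n = "length T"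
  let ?L = "max ?m ?n" and ?t = "result (build ?U)"
  let ?es = "edges ?U [] ?t" and ?Z = "replicate (?L + 2) (0 :: real)"
  define A0 where "A0 = arrays (snd (run (build ?U) initial))"
  define DS DT DST where D: "DS = length A0" "DT = length (A0 @ [?Z])" "DST = length ((A0 @ [?Z]) @ [?Z])"
  define A1 where "A1 = ((A0 @ [?Z]) @ [?Z]) @ [?Z]"
  define A2 where "A2 = add_ranges ?m ?n (DS, DT, DST) ?es A1"
  define A3 where "A3 = A2[DS := accumulated ?L (A2 ! DS)]"
  define A4 where "A4 = A3[DT := accumulated ?L (A3 ! DT)]"
  define A5 where "A5 = A4[DST := accumulated ?L (A4 ! DST)]"
  have wf: "wf_tree ?U [] ?t" by (rule wf_tree_subtree[OF node_at.root tree])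
  have A1: "A1 ! DS = ?Z" "A1 ! DT = ?Z" "A1 ! DST = ?Z"
    by (simp_all add: A1_def D nth_append del: replicate.simps)
  have ok1: "tables_ok ?L (DS, DT, DST) A1"
    by (simp add: tables_ok_def A1 del: replicate.simps) (simp add: A1_def D)
  then have ok2: "tables_ok ?L (DS, DT, DST) A2"
    unfolding A2_def by (rule tables_ok_add_ranges)
  have len: "length (accumulated l xs) = length xs" for l xs by (simp add: accumulated_def)
  have ok3: "tables_ok ?L (DS, DT, DST) A3"
    using ok2 by (simp add: A3_def tables_ok_def len nth_list_update)
  then have ok4: "tables_ok ?L (DS, DT, DST) A4"
    by (simp add: A4_def tables_ok_def len nth_list_update)
  have tables:
    "A5 ! DS = accumulated ?L (fold add_range (additions ?m ?n (\<lambda>(a, b). real (a ^ 2)) ?es) ?Z)"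
    "A5 ! DT = accumulated ?L (fold add_range (additions ?m ?n (\<lambda>(a, b). real (b ^ 2)) ?es) ?Z)"
    "A5 ! DST = accumulated ?L (fold add_range (additions ?m ?n (\<lambda>(a, b). real (a * b)) ?es) ?Z)"
    using ok1 ok2 ok3 ok4
    by (simp_all add: A5_def A4_def A3_def A2_def add_ranges_def tables_ok_def A1 del: replicate.simps)
  have val: "(\<Sum>k = 1..?L. \<rho> ^ k * theta_of (A5 ! DS ! k) (A5 ! DT ! k) (A5 ! DST ! k)) = d_rho \<rho> S T"
    unfolding d_rho_eq_sum
  proof (rule sum.cong[OF refl])
    fix k assume "k \<in> {1..?L}"
    then have k: "0 < k" "k \<le> ?L" by auto
    note acc = accumulated_additions[OF tree _ k]
    show "\<rho> ^ k * theta_of (A5 ! DS ! k) (A5 ! DT ! k) (A5 ! DST ! k) = \<rho> ^ k * theta k S T"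
      unfolding tables theta_eq_theta_of
      using acc[of "\<lambda>(a, b). real (a ^ 2)"] acc[of "\<lambda>(a, b). real (b ^ 2)"]
        acc[of "\<lambda>(a, b). real (a * b)"]
      by (simp del: replicate.simps)
  qed
  have build: "evals (build ?U) [] ?t A0 (running_time (build ?U))"
    unfolding A0_def by (rule evals_from_initial)
  note scatter = evals_scatter_tree[OF wf ok1, where m = ?m and n = ?n, folded A2_def, unfolded list.size(3)]
  have prefix_S: "evals (prefix_sums ?L DS) A2 () A3 (7 * ?L)"
    unfolding A3_def by (rule evals_prefix_sums) (use ok2 in \<open>simp_all add: tables_ok_def\<close>)
  have prefix_T: "evals (prefix_sums ?L DT) A3 () A4 (7 * ?L)"
    unfolding A4_def by (rule evals_prefix_sums) (use ok3 in \<open>simp_all add: tables_ok_def\<close>)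
  have prefix_ST: "evals (prefix_sums ?L DST) A4 () A5 (7 * ?L)"
    unfolding A5_def by (rule evals_prefix_sums) (use ok4 in \<open>simp_all add: tables_ok_def\<close>)
  have new: "evals (new (?L + 2)) A0 DS (A0 @ [?Z]) (?L + 3)"
    "evals (new (?L + 2)) (A0 @ [?Z]) DT ((A0 @ [?Z]) @ [?Z]) (?L + 3)"
    "evals (new (?L + 2)) ((A0 @ [?Z]) @ [?Z]) DST A1 (?L + 3)"
    unfolding D A1_def by (rule evals_conv[OF evals_new refl refl], simp)+
  have cost: "length ?es \<le> 2 * (?m + ?n + 2)"
  proof -
    have "length (leaves ?t) = card (set (leaves ?t))"
      using distinct_leaves[OF wf] by (simp add: distinct_card)
    then have "length (leaves ?t) = ?m + ?n + 2"
      by (simp add: set_leaves_suffix_tree[OF tree] length_joined)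
    then show ?thesis using edges_le_leaves[OF wf] by simp
  qed
  have total: "m + n + 2 + (16 + (m + n + 1 + (t + (32 * e + 19 + (l + 3 + (l + 3 + (l + 3 +
      (71 * e + 11 + (7 * l + (7 * l + (7 * l + 16 * l))))))))))) \<le> t + 500 * (m + n)"
    if "e \<le> 2 * (m + n + 2)" "l \<le> m + n" "1 \<le> m" "1 \<le> n" for m n t e l :: nat
    using that unfolding distrib_left by linarith
  have "1 \<le> ?m" "1 \<le> ?n" using nonempty by (simp_all add: Suc_le_eq)
  have "evals (gst_algorithm build \<rho> S T) [] (d_rho \<rho> S T) A5
    (running_time (build ?U) + 500 * (?m + ?n))"
    unfolding gst_algorithm_def Let_def
  proof (rule evals_conv,
      rule evals_bind, rule evals_reserve, rule evals_bind, rule evals_reserve,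
      rule evals_bind, rule evals_tick, rule evals_bind, rule build,
      rule evals_bind, rule evals_count_tree[where p = "[]" and U = ?U],
      rule evals_bind, rule new, rule evals_bind, rule new, rule evals_bind, rule new,
      rule evals_bind, rule scatter, rule evals_bind, rule prefix_S,
      rule evals_bind, rule prefix_T, rule evals_bind, rule prefix_ST,
      rule evals_evaluate, rule val, rule refl)
  qed (rule total[OF cost _ \<open>1 \<le> ?m\<close> \<open>1 \<le> ?n\<close>], simp)
  then show ?thesis by blast
qed

theorem proposition4p3:
  fixes build :: "'a::finite sym list \<Rightarrow> unit stree prog"
  assumes "constructs_suffix_trees build"
  shows "(\<forall>(\<rho>::real) (S::'a list) (T::'a list).
            \<rho> > 0 \<longrightarrow> S \<noteq> [] \<longrightarrow> T \<noteq> [] \<longrightarrow>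
            result (gst_algorithm build \<rho> S T) = d_rho \<rho> S T) \<and>
         (linear_time build \<longrightarrow>
           (\<exists>C::nat. \<forall>(\<rho>::real) (S::'a list) (T::'a list).
              \<rho> > 0 \<longrightarrow> S \<noteq> [] \<longrightarrow> T \<noteq> [] \<longrightarrow>
              running_time (gst_algorithm build \<rho> S T) \<le> C * (length S + length T) \<and>
              memory_usage (gst_algorithm build \<rho> S T) \<le> C * (length S + length T)))"
proof -
  have run: "result (gst_algorithm build \<rho> S T) = d_rho \<rho> S T \<and>
      running_time (gst_algorithm build \<rho> S T)
        \<le> running_time (build (joined S T)) + 500 * (length S + length T)"
    if "S \<noteq> []" "T \<noteq> []" for \<rho> and S T :: "'a list"
  proof -
    have "is_suffix_tree (joined S T) (result (build (joined S T)))"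
      using assms terminated_joined by (auto simp: constructs_suffix_trees_def)
    from evals_gst_algorithm[where build = build and S = S and T = T and \<rho> = \<rho>, OF this that]
    obtain A where "evals (gst_algorithm build \<rho> S T) [] (d_rho \<rho> S T) A
        (running_time (build (joined S T)) + 500 * (length S + length T))" by blast
    from result_and_time_of_evals[OF this] show ?thesis by simp
  qed
  show ?thesis
  proof (intro conjI impI)
    show "\<forall>(\<rho>::real) (S::'a list) (T::'a list).
        \<rho> > 0 \<longrightarrow> S \<noteq> [] \<longrightarrow> T \<noteq> [] \<longrightarrow> result (gst_algorithm build \<rho> S T) = d_rho \<rho> S T"
      using run by blast
  next
    assume "linear_time build"
    then obtain c where c: "\<And>U. terminated U \<Longrightarrow> running_time (build U) \<le> c * length U"
      by (auto simp: linear_time_def)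
    have "running_time (gst_algorithm build \<rho> S T) \<le> (500 + 2 * c) * (length S + length T)"
      if "S \<noteq> []" "T \<noteq> []" for \<rho> and S T :: "'a list"
    proof -
      have "1 \<le> length S" "1 \<le> length T" using that by (simp_all add: Suc_le_eq)
      then have "length (joined S T) \<le> 2 * (length S + length T)" by (simp add: length_joined)
      then have "c * length (joined S T) \<le> c * (2 * (length S + length T))" by (rule mult_le_mono2)
      with c[OF terminated_joined, of S T] run[OF that, of \<rho>] show ?thesis
        by (simp add: algebra_simps)
    qed
    then show "\<exists>C::nat. \<forall>(\<rho>::real) (S::'a list) (T::'a list).
              \<rho> > 0 \<longrightarrow> S \<noteq> [] \<longrightarrow> T \<noteq> [] \<longrightarrow>
              running_time (gst_algorithm build \<rho> S T) \<le> C * (length S + length T) \<and>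
              memory_usage (gst_algorithm build \<rho> S T) \<le> C * (length S + length T)"
      using memory_usage_le_running_time order_trans by blast
  qed
qed

end
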